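(* Suppose that: (I) $Y$ is forward invariant with respect to the solutions of $y'(t)=f(y(t),u(t))$, that is, $\mathcal{U}(y_0)=\mathcal{U}$ for all $y_0\in Y$; (II) there is an open neighbourhood $\mathcal{N}$ of $Y$ such that for every $y_0\in\mathcal{N}$ the limit $\lim_{T\rightarrow\infty}v_T(y_0)=:v^*(y_0)$ exists, the convergence being uniform with respect to $y_0\in\mathcal{N}$, and the limit function $v^*(\cdot)$ is Lipschitz continuous on $\mathcal{N}$. Let $y_0\in Y$ be such that $\Omega(y_0)\neq\emptyset$. Then the equality $$v^*(y_0)=k^*(y_0)$$ is valid if $d^*(y_0)=k^*(y_0)$, or if $v_{per}(y_0)=\liminf_{T\rightarrow\infty}v_T(y_0)$.
   Context: Setting. $U$ is a compact metric space, $f:\mathbb{R}^m\times U\to\mathbb{R}^m$ is continuous in $(y,u)$ and Lipschitz in $y$ uniformly in $u\in U$, $k:\mathbb{R}^m\times U\to\mathbb{R}$ is continuous, and $Y\subset\mathbb{R}^m$ is a compact set which is the closure of its interior. The control system is $y'(t)=f(y(t),u(t))$, $u(t)\in U$, $t\in[0,\infty)$. Controls are measurable functions $u(\cdot):[0,\infty)\to U$; $\mathcal{U}$ is the set of all controls, and $y(t,y_0,u)$ is the solution with control $u(\cdot)$ and $y(0)=y_0$. $\mathcal{U}(y_0)$ is the set of controls such that $y(t,y_0,u)\in Y$ for all $t\in[0,\infty)$. For $T>0$ and $y_0\in\mathcal{N}$, $$v_T(y_0)=\frac1T\inf_{u(\cdot)\in\mathcal{U}}\int_0^Tk(y(t,y_0,u),u(t))\,dt$$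 (for $y_0\in Y$, under (I), every control keeps the trajectory in $Y$, so this coincides with the infimum over controls satisfying the state constraint $y(t,y_0,u)\in Y$ for $t\in[0,T]$). A $y_0$-admissible $\mathcal{T}$-periodic pair ($\mathcal{T}>0$) is a pair $(y_{\mathcal{T}}(\cdot),u_{\mathcal{T}}(\cdot))$ where $u_{\mathcal{T}}(\cdot)\in\mathcal{U}(y_0)$ is $\mathcal{T}$-periodic and $y_{\mathcal{T}}(t)=y(t,y_0,u_{\mathcal{T}})$ is $\mathcal{T}$-periodic. $v_{per}(y_0)$ is the infimum of $\frac1{\mathcal{T}}\int_0^{\mathcal{T}}k(y_{\mathcal{T}}(t),u_{\mathcal{T}}(t))\,dt$ over all $\mathcal{T}>0$ and all $y_0$-admissible $\mathcal{T}$-periodic pairs (with $\inf\emptyset=+\infty$). $\mathcal{P}(Y\times U)$ and $\mathcal{M}_+(Y\times U)$ are the Borel probability measures and the finite non-negative Borel measures on $Y\times U$; $C^1$ is the space of continuously differentiable functions $\phi:\mathbb{R}^m\to\mathbb{R}$. Define $$W=\Big\{\gamma\in\mathcal{P}(Y\times U):\int_{Y\times U}\nabla\phi(y)^Tf(y,u)\,\gamma(dy,du)=0\ \ \forall\phi\in C^1\Big\},$$ let $\Omega(y_0)$ be the set of pairs $(\gamma,\xi)\in\mathcal{P}(Y\times U)\times\mathcal{M}_+(Y\times U)$ such that $\gamma\in W$ and $$\int_{Y\times U}(\phi(y_0)-\phi(y))\,\gamma(dy,du)+\int_{Y\times U}\nabla\phi(y)^Tf(y,u)\,\xi(dy,du)=0\quad\forall\phi\in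 C^1,$$ and let $k^*(y_0)=\inf_{(\gamma,\xi)\in\Omega(y_0)}\int_{Y\times U}k(y,u)\,\gamma(dy,du)$. $d^*(y_0)=\sup\mu$, the supremum being over all triplets $(\mu,\psi,\eta)\in\mathbb{R}\times C^1\times C^1$ such that for all $(y,u)\in Y\times U$: $k(y,u)+(\psi(y_0)-\psi(y))+\nabla\eta(y)^Tf(y,u)-\mu\ge0$ and $\nabla\psi(y)^Tf(y,u)\ge0$. *)

theory Defs
  imports "HOL-Probability.Probability"
begin

text \<open>
  Throughout, \<open>f\<close> is the right-hand side and \<open>k\<close> the running cost, both as functions of the pair
  \<open>(y, u)\<close>; the compact metric space of control values is a compact subset \<open>U\<close> of a type of class
  \<open>metric_space\<close>. Controls and trajectories are functions on \<open>real\<close> of which only the values on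
  \<open>[0, \<infinity>)\<close> matter. Optimal values that may be infinite are taken in \<open>ereal\<close>, where
  \<open>Inf {} = \<infinity>\<close>.
\<close>

subsection \<open>The control system\<close>

definition controls :: "'u::metric_space set \<Rightarrow> (real \<Rightarrow> 'u) set" where
  "controls U = (lebesgue_on {0..} \<rightarrow>\<^sub>M restrict_space borel U)"

text \<open>
  Since controls are only measurable, the differential equation is understood in the sense of
  Caratheodory, i.e. as the integral equation.
\<close>

definition is_solution ::
  "((real^'m) \<times> 'u \<Rightarrow> real^'m) \<Rightarrow> (real \<Rightarrow> 'u) \<Rightarrow> real^'m \<Rightarrow> (real \<Rightarrow> real^'m) \<Rightarrow> bool" where
  "is_solution f u y0 y \<longleftrightarrow>
     (\<forall>t\<ge>0. set_integrable lebesgue {0..t} (\<lambda>s. f (y s, u s)) \<and>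
             y t = y0 + (LINT s:{0..t}|lebesgue. f (y s, u s)))"

text \<open>
  If \<open>f\<close> is continuous and Lipschitz in \<open>y\<close> uniformly in the control value, a solution exists on
  \<open>[0, \<infinity>)\<close> for every control and is unique there, so on \<open>[0, \<infinity>)\<close> the choice below is
  determined.
\<close>

definition traj ::
  "((real^'m) \<times> 'u \<Rightarrow> real^'m) \<Rightarrow> real^'m \<Rightarrow> (real \<Rightarrow> 'u) \<Rightarrow> real \<Rightarrow> real^'m" where
  "traj f y0 u = (SOME y. is_solution f u y0 y)"

definition admissible_controls ::
  "((real^'m) \<times> 'u \<Rightarrow> real^'m) \<Rightarrow> 'u::metric_space set \<Rightarrow> (real^'m) set \<Rightarrow> real^'m
    \<Rightarrow> (real \<Rightarrow> 'u) set" where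
  "admissible_controls f U Y y0 = {u \<in> controls U. \<forall>t\<ge>0. traj f y0 u t \<in> Y}"


subsection \<open>Long-run average and periodic optimal values\<close>

text \<open>
  The infimum is over all controls, without state constraint. It is an infimum of reals: for
  nonempty compact \<open>U\<close> the family is nonempty, and it is bounded because the trajectories from
  \<open>y0\<close> stay in a compact set up to time \<open>T\<close>. Only \<open>T > 0\<close> is meaningful.
\<close>

definition v_T ::
  "((real^'m) \<times> 'u \<Rightarrow> real^'m) \<Rightarrow> ((real^'m) \<times> 'u \<Rightarrow> real) \<Rightarrow> 'u::metric_space set
    \<Rightarrow> real \<Rightarrow> real^'m \<Rightarrow> real" where
  "v_T f k U T y0 =
     1 / T * (INF u\<in>controls U. LINT t:{0..T}|lebesgue. k (traj f y0 u t, u t))"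

definition v_star ::
  "((real^'m) \<times> 'u \<Rightarrow> real^'m) \<Rightarrow> ((real^'m) \<times> 'u \<Rightarrow> real) \<Rightarrow> 'u::metric_space set
    \<Rightarrow> real^'m \<Rightarrow> real" where
  "v_star f k U y0 = Lim at_top (\<lambda>T. v_T f k U T y0)"

definition periodic_from_0 :: "real \<Rightarrow> (real \<Rightarrow> 'a) \<Rightarrow> bool" where
  "periodic_from_0 T g \<longleftrightarrow> (\<forall>t\<ge>0. g (t + T) = g t)"

definition admissible_periodic_pairs ::
  "((real^'m) \<times> 'u \<Rightarrow> real^'m) \<Rightarrow> 'u::metric_space set \<Rightarrow> (real^'m) set \<Rightarrow> real^'m \<Rightarrow> real
    \<Rightarrow> ((real \<Rightarrow> real^'m) \<times> (real \<Rightarrow> 'u)) set" where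
  "admissible_periodic_pairs f U Y y0 T =
     {(y, u). u \<in> admissible_controls f U Y y0 \<and> periodic_from_0 T u \<and>
              y = traj f y0 u \<and> periodic_from_0 T y}"

definition v_per ::
  "((real^'m) \<times> 'u \<Rightarrow> real^'m) \<Rightarrow> ((real^'m) \<times> 'u \<Rightarrow> real) \<Rightarrow> 'u::metric_space set
    \<Rightarrow> (real^'m) set \<Rightarrow> real^'m \<Rightarrow> ereal" where
  "v_per f k U Y y0 =
     Inf {ereal (1 / T * (LINT t:{0..T}|lebesgue. k (y t, u t))) | T y u.
            T > 0 \<and> (y, u) \<in> admissible_periodic_pairs f U Y y0 T}"


subsection \<open>The linear programming problem and its dual\<close>

definition gradient :: "(real^'m \<Rightarrow> real) \<Rightarrow> real^'m \<Rightarrow> real^'m" where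
  "gradient \<phi> y = (THE D. GDERIV \<phi> y :> D)"

definition C1 :: "(real^'m \<Rightarrow> real) set" where
  "C1 = {\<phi>. (\<forall>y. \<exists>D. GDERIV \<phi> y :> D) \<and> continuous_on UNIV (gradient \<phi>)}"

text \<open>
  The requirement on \<open>sets\<close> forces \<open>space M = S\<close>.
\<close>

definition borel_prob_measures :: "'a::topological_space set \<Rightarrow> 'a measure set" where
  "borel_prob_measures S = {M. sets M = sets (restrict_space borel S) \<and> prob_space M}"

definition borel_finite_measures :: "'a::topological_space set \<Rightarrow> 'a measure set" where
  "borel_finite_measures S = {M. sets M = sets (restrict_space borel S) \<and> finite_measure M}"

definition W ::
  "((real^'m) \<times> 'u \<Rightarrow> real^'m) \<Rightarrow> 'u::metric_space set \<Rightarrow> (real^'m) set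
    \<Rightarrow> ((real^'m) \<times> 'u) measure set" where
  "W f U Y = {\<gamma> \<in> borel_prob_measures (Y \<times> U).
     \<forall>\<phi>\<in>C1. (LINT z|\<gamma>. gradient \<phi> (fst z) \<bullet> f z) = 0}"

definition Omega ::
  "((real^'m) \<times> 'u \<Rightarrow> real^'m) \<Rightarrow> 'u::metric_space set \<Rightarrow> (real^'m) set \<Rightarrow> real^'m
    \<Rightarrow> (((real^'m) \<times> 'u) measure \<times> ((real^'m) \<times> 'u) measure) set" where
  "Omega f U Y y0 =
     {(\<gamma>, \<xi>). \<gamma> \<in> borel_prob_measures (Y \<times> U) \<and> \<xi> \<in> borel_finite_measures (Y \<times> U) \<and>
        \<gamma> \<in> W f U Y \<and>
        (\<forall>\<phi>\<in>C1. (LINT z|\<gamma>. \<phi> y0 - \<phi> (fst z)) +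
                 (LINT z|\<xi>. gradient \<phi> (fst z) \<bullet> f z) = 0)}"

definition k_star ::
  "((real^'m) \<times> 'u \<Rightarrow> real^'m) \<Rightarrow> ((real^'m) \<times> 'u \<Rightarrow> real) \<Rightarrow> 'u::metric_space set
    \<Rightarrow> (real^'m) set \<Rightarrow> real^'m \<Rightarrow> ereal" where
  "k_star f k U Y y0 = (INF (\<gamma>, \<xi>)\<in>Omega f U Y y0. ereal (LINT z|\<gamma>. k z))"

definition d_star ::
  "((real^'m) \<times> 'u \<Rightarrow> real^'m) \<Rightarrow> ((real^'m) \<times> 'u \<Rightarrow> real) \<Rightarrow> 'u::metric_space set
    \<Rightarrow> (real^'m) set \<Rightarrow> real^'m \<Rightarrow> ereal" where
  "d_star f k U Y y0 =
     Sup {ereal \<mu> | \<mu> \<psi> \<eta>. \<psi> \<in> C1 \<and> \<eta> \<in> C1 \<and>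
            (\<forall>y\<in>Y. \<forall>u\<in>U.
               k (y, u) + (\<psi> y0 - \<psi> y) + gradient \<eta> y \<bullet> f (y, u) - \<mu> \<ge> 0 \<and>
               gradient \<psi> y \<bullet> f (y, u) \<ge> 0)}"

end

theory Submission
  imports Defs
begin

text \<open>
  Write \<open>v*\<close> for the long-run value. The inequality \<open>v* y0 \<le> k* y0\<close> always holds under the
  assumptions on \<open>Y\<close> and on the limit, and each of the two alternatives supplies the reverse
  inequality.

  For \<open>v* \<le> k*\<close>, let \<open>(\<gamma>, \<xi>)\<close> be feasible. The claim is the chain
  \<open>v* y0 \<le> (LINT z|\<gamma>. v* (fst z)) \<le> (LINT z|\<gamma>. k z)\<close>. If \<open>v*\<close> were \<open>C1\<close>, the first step would follow
  from the equation coupling \<open>\<gamma>\<close> and \<open>\<xi>\<close>, because \<open>v*\<close> does not decrease along trajectories (Bellman's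
  principle for \<open>T * v_T\<close>, divided by \<open>T\<close>). The second step asks for a function \<open>\<phi>\<close> with
  \<open>v* - k \<le> gradient \<phi> \<bullet> f\<close> up to a small error, since \<open>\<gamma>\<close> integrates the right-hand side to zero.
  Formally the average over \<open>s \<in> [0, T]\<close> of the value functions with horizon \<open>s\<close> does this: along any
  trajectory its rate of change is at least \<open>v_T - k\<close>. The function used here is the variant in which
  the average is taken before the infimum (\<open>weighted_val\<close>).

  Both functions are only Lipschitz (the second after replacing \<open>k\<close> by a uniform approximation that is
  Lipschitz in \<open>y\<close>, \<open>lipschitz_approximation\<close>), and what dynamic programming yields is a one-sided
  inequality along short pieces of trajectories with constant control. Such an inequality is stable
  under mollification: averaging over small translations costs an error proportional to the
  translation, because the function and \<open>f\<close> are Lipschitz. The result is a \<open>C1\<close> function with the same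
  differential inequality up to \<open>\<epsilon>\<close> (\<open>smooth_subsolution\<close>, \<open>smooth_subsolution_flow\<close>). The mollification
  needs the inequality in a neighbourhood of \<open>Y\<close>, which is why \<open>v*\<close> has to be controlled on \<open>N\<close> and
  not just on \<open>Y\<close>.

  For the reverse inequality, \<open>d* \<le> v*\<close> holds because a dual feasible triple, integrated along a
  trajectory, bounds the cost of every control from below (\<open>dual_feasible_le_vs\<close>). Likewise
  \<open>k* \<le> v_per\<close> holds because a periodic pair induces a feasible pair of measures: \<open>\<gamma>\<close> is its
  normalised occupation measure and \<open>\<xi>\<close> weights time \<open>s\<close> by \<open>(T - s) / T\<close>, the weight produced by
  exchanging the order of integration in the time average of \<open>\<phi> (y t) - \<phi> y0\<close>
  (\<open>periodic_occupation_in_Omega\<close>).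

  Trajectories solve integral equations with merely measurable controls. The pointwise facts about
  them rest on three elementary devices: Banach's fixed point theorem in an exponentially weighted
  supremum norm for existence, Gronwall's inequality for uniqueness and continuous dependence, and
  for the chain rule the principle that a function whose increments are \<open>o(h)\<close> is constant.
\<close>

section \<open>Auxiliary facts on integrals\<close>

lemma continuous_bounded_on_compact:
  fixes g :: "'a::topological_space \<Rightarrow> 'b::real_normed_vector"
  assumes "compact K" "continuous_on K g"
  obtains B where "0 \<le> B" "\<And>x. x \<in> K \<Longrightarrow> norm (g x) \<le> B"
proof -
  have "compact (g ` K)" using assms by (intro compact_continuous_image)
  then obtain B where "\<forall>x\<in>g ` K. norm x \<le> B" using compact_imp_bounded bounded_iff by metis
  then show ?thesis by (intro that[of "max 0 B"]) (auto simp: le_max_iff_disj)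
qed

lemma norm_integral_le:
  fixes F :: "real \<Rightarrow> 'a::euclidean_space"
  assumes "F integrable_on {a..b}" "a \<le> b" "0 \<le> C" "\<And>t. t \<in> {a..b} \<Longrightarrow> norm (F t) \<le> C"
  shows "norm (integral {a..b} F) \<le> C * (b - a)"
  using has_integral_bound[of C F "integral {a..b} F" a b] assms by (auto simp: integrable_integral)

lemmas absolutely_integrable_imp_integrable = set_lebesgue_integral_eq_integral(1)

lemma gronwall_integral:
  fixes w :: "real \<Rightarrow> real"
  assumes w: "continuous_on {0..t} w" and L: "0 \<le> L"
    and le: "\<And>s. s \<in> {0..t} \<Longrightarrow> w s \<le> d + L * integral {0..s} w"
    and s: "s \<in> {0..t}"
  shows "w s \<le> d * exp (L * s)"
proof -
  define P where "P s = exp (- L * s) * (d + L * integral {0..s} w)" for s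
  have "\<exists>D. (P has_real_derivative D) (at r within {0..t}) \<and> D \<le> 0" if r: "r \<in> {0..t}" for r
  proof -
    have "((\<lambda>s. integral {0..s} w) has_real_derivative w r) (at r within {0..t})"
      using integral_has_vector_derivative[OF w r] by (simp add: has_real_derivative_iff_has_vector_derivative)
    then have "(P has_real_derivative exp (- L * r) * (L * w r) +
        (exp (- L * r) * - L) * (d + L * integral {0..r} w)) (at r within {0..t})"
      unfolding P_def by (auto intro!: derivative_eq_intros)
    moreover have "exp (- L * r) * (L * w r) + (exp (- L * r) * - L) * (d + L * integral {0..r} w)
        = exp (- L * r) * L * (w r - (d + L * integral {0..r} w))"
      by (simp add: algebra_simps)
    moreover have "\<dots> \<le> 0"
      using le[OF r] L by (intro mult_nonneg_nonpos) auto
    ultimately show ?thesis by metis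
  qed
  moreover have "continuous_on {0..t} P"
    using w unfolding P_def
    by (intro continuous_intros indefinite_integral_continuous_1 integrable_continuous_real)
  ultimately have "P s \<le> P 0"
    using s
  proof (intro DERIV_nonpos_imp_decreasing_open[of 0 s P])
    fix r assume D: "\<And>r. r \<in> {0..t} \<Longrightarrow> \<exists>D. (P has_real_derivative D) (at r within {0..t}) \<and> D \<le> 0"
      and r: "0 < r" "r < s"
    then have "at r within {0..t} = at r" and "r \<in> {0..t}"
      using s by (auto intro: at_within_Icc_at)
    then show "\<exists>D. (P has_real_derivative D) (at r) \<and> D \<le> 0"
      using D by metis
  qed (auto elim: continuous_on_subset)
  then have "exp (L * s) * P s \<le> exp (L * s) * d" by (simp add: P_def)
  also have "exp (L * s) * P s = d + L * integral {0..s} w"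
    by (simp add: P_def exp_minus flip: mult.assoc)
  finally show ?thesis using le[OF s] by (simp add: mult.commute)
qed

text \<open>
  The increment is only required to be small on intervals having \<open>t\<close> as an end point, which makes the
  derivative at \<open>t\<close> vanish. In this form the estimate can be made on an interval \<open>[a, b]\<close> without
  distinguishing the two sides of \<open>t\<close>. It replaces differentiation of integrals with measurable
  integrands, which are differentiable only almost everywhere.
\<close>

lemma constant_if_increment_small:
  fixes F :: "real \<Rightarrow> real"
  assumes T: "0 \<le> T"
    and small: "\<And>t e. t \<in> {0..T} \<Longrightarrow> 0 < e \<Longrightarrow>
      \<exists>d>0. \<forall>a b. 0 \<le> a \<longrightarrow> a \<le> b \<longrightarrow> b \<le> T \<longrightarrow> b - a < d \<longrightarrow> (t = a \<or> t = b) \<longrightarrow> \<bar>F b - F a\<bar> \<le> e * (b - a)"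
  shows "F T = F 0"
proof -
  have "(F has_derivative (\<lambda>h. 0)) (at t within {0..T})" if t: "t \<in> {0..T}" for t
    unfolding has_derivative_within_alt
  proof (intro conjI bounded_linear_zero allI impI)
    fix e :: real assume e: "0 < e"
    obtain d where d: "0 < d" "\<And>a b. 0 \<le> a \<Longrightarrow> a \<le> b \<Longrightarrow> b \<le> T \<Longrightarrow> b - a < d \<Longrightarrow> t = a \<or> t = b
        \<Longrightarrow> \<bar>F b - F a\<bar> \<le> e * (b - a)"
      using small[OF t e] by blast
    show "\<exists>d>0. \<forall>y\<in>{0..T}. norm (y - t) < d \<longrightarrow> norm (F y - F t - 0) \<le> e * norm (y - t)"
    proof (intro exI[of _ d] conjI d(1) ballI impI)
      fix y assume y: "y \<in> {0..T}" "norm (y - t) < d"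
      show "norm (F y - F t - 0) \<le> e * norm (y - t)"
        using d(2)[of y t] d(2)[of t y] y t by (cases "y \<le> t") (auto simp: abs_minus_commute)
    qed
  qed
  then have "\<exists>c. \<forall>t\<in>{0..T}. F t = c"
    by (intro has_derivative_zero_constant) auto
  then show ?thesis using T by auto
qed

text \<open>
  Integration by parts for the indefinite integral of a bounded measurable function. The difference of
  the two sides, as a function of the upper limit, has increments of second order.
\<close>

lemma iterated_integral_eq_weighted:
  fixes G :: "real \<Rightarrow> real"
  assumes T: "0 \<le> T" and G: "G integrable_on {0..T}" and sG: "(\<lambda>s. s * G s) integrable_on {0..T}"
    and B: "\<And>t. t \<in> {0..T} \<Longrightarrow> \<bar>G t\<bar> \<le> B"
  shows "integral {0..T} (\<lambda>t. integral {0..t} G) = integral {0..T} (\<lambda>s. (T - s) * G s)"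
proof -
  have B0: "0 \<le> B" using B[of 0] T by (auto intro: order_trans[OF abs_ge_zero])
  let ?I = "\<lambda>t. integral {0..t} G"
  have int: "G integrable_on {a..b}" "(\<lambda>s. s * G s) integrable_on {a..b}" if "0 \<le> a" "b \<le> T" for a b
    using that by (auto intro: integrable_on_subinterval[OF G] integrable_on_subinterval[OF sG])
  have Icont: "continuous_on {0..T} ?I" by (rule indefinite_integral_continuous_1[OF G])
  have Iint: "?I integrable_on {a..b}" if "0 \<le> a" "b \<le> T" for a b
    using that by (intro integrable_continuous_real continuous_on_subset[OF Icont]) auto
  have I_diff: "?I b - ?I a = integral {a..b} G" if "0 \<le> a" "a \<le> b" "b \<le> T" for a b
    using Henstock_Kurzweil_Integration.integral_combine[of 0 a b G] that int(1)[of 0 b] by simp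
  have I_lip: "\<bar>?I b - ?I a\<bar> \<le> B * (b - a)" if "0 \<le> a" "a \<le> b" "b \<le> T" for a b
    unfolding I_diff[OF that] real_norm_def[symmetric]
    by (rule norm_integral_le) (use that B B0 int in auto)
  \<comment> \<open>The first two terms are the integral of \<open>(t - s) * G s\<close> over \<open>[0, t]\<close>.\<close>
  define F where "F t = t * ?I t - integral {0..t} (\<lambda>s. s * G s) - integral {0..t} ?I" for t
  have "F T = F 0"
  proof (rule constant_if_increment_small[OF T])
    fix t e :: real assume t: "t \<in> {0..T}" and e: "0 < e"
    have inc: "\<bar>F b - F a\<bar> \<le> (3 * B * (b - a)) * (b - a)" if ab: "0 \<le> a" "a \<le> b" "b \<le> T" for a b
    proof -
      have "integral {a..b} (\<lambda>s. s * G s) = integral {a..b} (\<lambda>s. (s - a) * G s) + a * (?I b - ?I a)"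
      proof -
        have "integral {a..b} (\<lambda>s. (s - a) * G s) = integral {a..b} (\<lambda>s. s * G s - a * G s)"
          by (simp add: left_diff_distrib)
        also have "\<dots> = integral {a..b} (\<lambda>s. s * G s) - a * integral {a..b} G"
          using int[of a b] ab by (simp add: integral_diff integrable_on_mult_right)
        finally show ?thesis using I_diff[OF ab] by simp
      qed
      moreover have "integral {a..b} ?I = integral {a..b} (\<lambda>s. ?I s - ?I a) + ?I a * (b - a)"
        using Iint[of a b] ab by (simp add: integral_diff integrable_const_ivl)
      moreover have "integral {0..b} (\<lambda>s. s * G s) - integral {0..a} (\<lambda>s. s * G s) = integral {a..b} (\<lambda>s. s * G s)"
        using Henstock_Kurzweil_Integration.integral_combine[of 0 a b "\<lambda>s. s * G s"] ab int(2)[of 0 b] by simp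
      moreover have "integral {0..b} ?I - integral {0..a} ?I = integral {a..b} ?I"
        using Henstock_Kurzweil_Integration.integral_combine[of 0 a b ?I] ab Iint[of 0 b] by simp
      ultimately have "F b - F a = (b - a) * (?I b - ?I a) - integral {a..b} (\<lambda>s. (s - a) * G s)
          - integral {a..b} (\<lambda>s. ?I s - ?I a)"
        unfolding F_def by (simp add: algebra_simps)
      moreover have "\<bar>(b - a) * (?I b - ?I a)\<bar> \<le> (b - a) * (B * (b - a))"
        unfolding abs_mult using I_lip[OF ab] ab by (intro mult_mono) auto
      moreover have "norm (integral {a..b} (\<lambda>s. (s - a) * G s)) \<le> ((b - a) * B) * (b - a)"
      proof (rule norm_integral_le)
        show "(\<lambda>s. (s - a) * G s) integrable_on {a..b}"
          unfolding left_diff_distrib using int[of a b] ab by (intro integrable_diff integrable_on_mult_right) auto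
        show "norm ((s - a) * G s) \<le> (b - a) * B" if "s \<in> {a..b}" for s
          unfolding norm_mult using that ab B[of s] by (intro mult_mono) auto
      qed (use ab B0 in auto)
      moreover have "norm (integral {a..b} (\<lambda>s. ?I s - ?I a)) \<le> (B * (b - a)) * (b - a)"
      proof (rule norm_integral_le)
        show "(\<lambda>s. ?I s - ?I a) integrable_on {a..b}"
          using ab by (intro integrable_diff Iint integrable_const_ivl) auto
        show "norm (?I s - ?I a) \<le> B * (b - a)" if "s \<in> {a..b}" for s
          using I_lip[of a s] that ab mult_left_mono[of "s - a" "b - a" B] B0 by auto
      qed (use ab B0 in auto)
      ultimately show ?thesis by (simp add: abs_le_iff algebra_simps)
    qed
    show "\<exists>d>0. \<forall>a b. 0 \<le> a \<longrightarrow> a \<le> b \<longrightarrow> b \<le> T \<longrightarrow> b - a < d \<longrightarrow> t = a \<or> t = b \<longrightarrow>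
        \<bar>F b - F a\<bar> \<le> e * (b - a)"
    proof (intro exI[of _ "e / (3 * B + 1)"] conjI allI impI)
      show "0 < e / (3 * B + 1)" using e B0 by simp
      fix a b assume ab: "0 \<le> a" "a \<le> b" "b \<le> T" and d: "b - a < e / (3 * B + 1)"
      have "(b - a) * (3 * B + 1) \<le> e" using d B0 by (simp add: pos_less_divide_eq)
      then have "3 * B * (b - a) \<le> e" using ab by (simp add: algebra_simps)
      then have "(3 * B * (b - a)) * (b - a) \<le> e * (b - a)" using ab by (intro mult_right_mono) auto
      then show "\<bar>F b - F a\<bar> \<le> e * (b - a)" using inc[OF ab] by simp
    qed
  qed
  then have "integral {0..T} ?I = T * ?I T - integral {0..T} (\<lambda>s. s * G s)" by (simp add: F_def)
  also have "\<dots> = integral {0..T} (\<lambda>s. T * G s - s * G s)"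
    using G sG by (simp add: integral_diff integrable_on_mult_right)
  finally show ?thesis by (simp add: left_diff_distrib)
qed

text \<open>
  On the shifted window the weight \<open>1 - t / T\<close> is larger by \<open>h / T\<close>. So delaying the window by \<open>h\<close>
  loses the initial integral of \<open>G\<close> over \<open>[0, h]\<close> and gains \<open>h\<close> times the mean of \<open>G\<close> over \<open>[0, T]\<close>; all other
  contributions are of second order in \<open>h\<close>. With \<open>G\<close> the running cost this is the source of the term
  \<open>v_T - k\<close> in the differential inequality for the averaged cost.
\<close>

lemma window_shift:
  fixes G :: "real \<Rightarrow> real"
  assumes T: "0 < T" and h: "0 < h" and G: "G absolutely_integrable_on {0..T + h}"
    and wG: "(\<lambda>t. (1 - t / T) * G t) absolutely_integrable_on {0..T + h}"
    and B: "\<And>t. t \<in> {0..T + h} \<Longrightarrow> \<bar>G t\<bar> \<le> B"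
  shows "integral {0..T} (\<lambda>t. (1 - t / T) * G t) - integral {0..h} G + h / T * integral {0..T} G
      - 4 * B * h\<^sup>2 / T \<le> integral {0..T} (\<lambda>s. (1 - s / T) * G (h + s))"
proof -
  let ?w = "\<lambda>t. (1 - t / T) * G t"
  have int: "G integrable_on {a..b}" "?w integrable_on {a..b}" if "0 \<le> a" "b \<le> T + h" for a b
    using that G wG by (auto intro: integrable_on_subinterval dest: absolutely_integrable_imp_integrable)
  note bound = norm_integral_le[where 'a=real, unfolded real_norm_def]
  have B0: "0 \<le> B" using B[of 0] T h by (auto intro: order_trans[OF abs_ge_zero])
  have "integral {0..T} (\<lambda>s. (1 - s / T) * G (h + s))
      = integral {0..T} ((\<lambda>t. (1 - t / T) * G t + h / T * G t) \<circ> (+) h)"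
    using T by (intro integral_cong) (simp add: field_simps)
  also have "\<dots> = integral {h..T + h} (\<lambda>t. (1 - t / T) * G t + h / T * G t)"
    using integral_shift_Icc_real[of 0 T _ h] by simp
  also have "\<dots> = integral {h..T + h} ?w + h / T * integral {h..T + h} G"
    using h by (subst integral_add)
      (auto intro!: int simp del: times_divide_eq_left intro: integrable_on_mult_right)
  finally have eq: "integral {0..T} (\<lambda>s. (1 - s / T) * G (h + s))
      = integral {h..T + h} ?w + h / T * integral {h..T + h} G" .
  have split: "integral {h..T + h} F = integral {0..T} F + integral {T..T + h} F - integral {0..h} F"
    if "F integrable_on {0..T + h}" for F :: "real \<Rightarrow> real"
    using Henstock_Kurzweil_Integration.integral_combine[of 0 T "T + h" F]
      Henstock_Kurzweil_Integration.integral_combine[of 0 h "T + h" F] that T h by simp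
  have w_tail: "\<bar>integral {T..T + h} ?w\<bar> \<le> (h / T * B) * h"
  proof -
    have "\<bar>integral {T..T + h} ?w\<bar> \<le> (h / T * B) * (T + h - T)"
    proof (rule bound)
      fix t assume t: "t \<in> {T..T + h}"
      have "\<bar>1 - t / T\<bar> = (t - T) / T" using t T by (auto simp: abs_if field_simps)
      also have "\<dots> \<le> h / T" using t T by (intro divide_right_mono) auto
      finally show "\<bar>?w t\<bar> \<le> h / T * B"
        unfolding abs_mult using B[of t] t T h by (intro mult_mono) auto
    qed (use T h B0 in \<open>auto intro!: int\<close>)
    then show ?thesis by simp
  qed
  have w_head: "integral {0..h} ?w - integral {0..h} G \<le> (h / T * B) * h"
  proof -
    have "\<bar>integral {0..h} (\<lambda>t. ?w t - G t)\<bar> \<le> (h / T * B) * (h - 0)"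
    proof (rule bound)
      fix t assume t: "t \<in> {0..h}"
      have "?w t - G t = - (t / T) * G t" by (simp add: algebra_simps)
      then have "\<bar>?w t - G t\<bar> = t / T * \<bar>G t\<bar>" using t T by (simp add: abs_mult)
      also have "\<dots> \<le> h / T * B" using t T h B[of t] by (intro mult_mono divide_right_mono) auto
      finally show "\<bar>?w t - G t\<bar> \<le> h / T * B" .
    qed (use T h B0 in \<open>auto intro!: int integrable_diff\<close>)
    then show ?thesis using T h by (simp add: integral_diff int)
  qed
  have "\<bar>integral {T..T + h} G\<bar> \<le> B * (T + h - T)" "\<bar>integral {0..h} G\<bar> \<le> B * (h - 0)"
    by (rule bound; use T h B B0 in \<open>auto intro!: int\<close>)+
  then have "h / T * (integral {0..T} G - 2 * B * h) \<le> h / T * integral {h..T + h} G"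
    using T h split[OF int(1)] by (intro mult_left_mono) auto
  moreover have "h / T * (integral {0..T} G - 2 * B * h) = h / T * integral {0..T} G - 2 * (h / T * B * h)"
    by (simp add: right_diff_distrib)
  moreover have "4 * B * h\<^sup>2 / T = 4 * (h / T * B * h)"
    by (simp add: power2_eq_square)
  ultimately show ?thesis
    unfolding eq using split[OF int(2)[of 0 "T + h"]] w_tail w_head by linarith
qed

section \<open>Measurability and integrability along controls\<close>

text \<open>
  An open subset of the product is the union of the boxes \<open>b \<times> V b\<close> over a countable base of the first
  factor, \<open>V b\<close> being the largest admissible open set. Hence one second countable factor is enough;
  the space of control values is an arbitrary metric space.
\<close>

lemma measurable_Pair_second_countable:
  fixes y :: "'s \<Rightarrow> 'a::second_countable_topology" and u :: "'s \<Rightarrow> 'b::topological_space"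
  assumes y: "y \<in> borel_measurable M" and u: "u \<in> borel_measurable M"
  shows "(\<lambda>s. (y s, u s)) \<in> borel_measurable M"
proof (rule borel_measurableI)
  fix S :: "('a \<times> 'b) set" assume S: "open S"
  obtain B :: "'a set set" where B: "countable B" "topological_basis B"
    using ex_countable_basis by blast
  define V where "V b = \<Union>{V. open V \<and> b \<times> V \<subseteq> S}" for b
  have oV: "open (V b)" for b unfolding V_def by blast
  have "S = (\<Union>b\<in>B. b \<times> V b)"
  proof (intro equalityI subsetI)
    fix p assume "p \<in> S"
    then obtain A C where AC: "open A" "open C" "p \<in> A \<times> C" "A \<times> C \<subseteq> S"
      by (rule open_prod_elim[OF S])
    then have "fst p \<in> A" by auto
    with AC obtain b where "b \<in> B" "fst p \<in> b" "b \<subseteq> A"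
      using topological_basisE[OF B(2), of A "fst p"] by metis
    then show "p \<in> (\<Union>b\<in>B. b \<times> V b)"
      using AC unfolding V_def mem_Times_iff UN_iff by (intro bexI[of _ b]) auto
  qed (auto simp: V_def)
  then have "(\<lambda>s. (y s, u s)) -` S \<inter> space M
      = (\<Union>b\<in>B. (y -` b \<inter> space M) \<inter> (u -` V b \<inter> space M))"
    by auto
  also have "\<dots> \<in> sets M"
    using B oV topological_basis_open[OF B(2)] measurable_sets[OF y] measurable_sets[OF u]
    by (intro sets.countable_UN' sets.Int) auto
  finally show "(\<lambda>s. (y s, u s)) -` S \<inter> space M \<in> sets M" .
qed

lemma control_in: "u \<in> controls U \<Longrightarrow> 0 \<le> t \<Longrightarrow> u t \<in> U"
  by (auto simp: controls_def space_restrict_space dest!: measurable_space[where x=t])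

lemma control_pair_measurable:
  fixes y :: "real \<Rightarrow> real^'m" and U :: "'u::metric_space set"
  assumes u: "u \<in> controls U" and y: "continuous_on {a..b} y" and a: "0 \<le> a"
    and K: "y ` {a..b} \<subseteq> K"
  shows "(\<lambda>s. (y s, u s)) \<in> lebesgue_on {a..b} \<rightarrow>\<^sub>M restrict_space borel (K \<times> U)"
proof (rule measurable_restrict_space2)
  show "(\<lambda>s. (y s, u s)) \<in> space (lebesgue_on {a..b}) \<rightarrow> K \<times> U"
    using K a control_in[OF u] by auto
  have "u \<in> borel_measurable (lebesgue_on {0..})"
    using u by (auto simp: controls_def measurable_restrict_space2_iff)
  then have "u \<in> borel_measurable (lebesgue_on {a..b})"
    by (rule measurable_restrict_mono) (use a in auto)
  moreover have "y \<in> borel_measurable (lebesgue_on {a..b})"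
    using y by (intro continuous_imp_measurable_on_sets_lebesgue) auto
  ultimately show "(\<lambda>s. (y s, u s)) \<in> borel_measurable (lebesgue_on {a..b})"
    by (intro measurable_Pair_second_countable)
qed

lemma control_integrable:
  fixes y :: "real \<Rightarrow> real^'m" and U :: "'u::metric_space set"
    and g :: "(real^'m) \<times> 'u \<Rightarrow> 'b::euclidean_space"
  assumes u: "u \<in> controls U" and y: "continuous_on {a..b} y" and a: "0 \<le> a"
    and K: "y ` {a..b} \<subseteq> K" and U: "compact U" and g: "continuous_on (K \<times> U) g"
  shows "(\<lambda>s. g (y s, u s)) absolutely_integrable_on {a..b}"
proof -
  have "compact (y ` {a..b} \<times> U)"
    using y U by (intro compact_Times compact_continuous_image) auto
  moreover have "continuous_on (y ` {a..b} \<times> U) g"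
    using K by (intro continuous_on_subset[OF g]) auto
  ultimately obtain B where B: "\<And>z. z \<in> y ` {a..b} \<times> U \<Longrightarrow> norm (g z) \<le> B"
    using continuous_bounded_on_compact by blast
  have "(\<lambda>s. g (y s, u s)) \<in> borel_measurable (lebesgue_on {a..b})"
    by (rule measurable_compose[OF control_pair_measurable[OF u y a K]
          borel_measurable_continuous_on_restrict[OF g]])
  then show ?thesis
    by (rule measurable_bounded_by_integrable_imp_absolutely_integrable[where g="\<lambda>_. B"])
      (use a control_in[OF u] in \<open>auto intro!: B\<close>)
qed

lemma control_integrable_weighted:
  fixes y :: "real \<Rightarrow> real^'m" and U :: "'u::metric_space set"
    and g :: "(real^'m) \<times> 'u \<Rightarrow> real"
  assumes "u \<in> controls U" "continuous_on {a..b} y" "0 \<le> a" "y ` {a..b} \<subseteq> K" "compact U"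
    "continuous_on (K \<times> U) g" and w: "continuous_on {a..b} w"
  shows "(\<lambda>s. w s * g (y s, u s)) absolutely_integrable_on {a..b}"
proof (rule absolutely_integrable_bounded_measurable_product_real)
  show "w \<in> borel_measurable (lebesgue_on {a..b})"
    using w by (intro continuous_imp_measurable_on_sets_lebesgue) auto
  show "bounded (w ` {a..b})"
    using w by (intro compact_imp_bounded compact_continuous_image) auto
  show "(\<lambda>s. g (y s, u s)) absolutely_integrable_on {a..b}"
    using control_integrable assms(1-6) by blast
qed auto

text \<open>
  The control that uses the constant value \<open>a\<close> on \<open>[0, h)\<close> and continues with \<open>u\<close>, restarted at time
  \<open>h\<close>. The case distinction is on \<open>t - h\<close> so that the function is the composition of a translation
  with the extension of \<open>u\<close> by \<open>a\<close> to the negative half-line; measurability is read off from that.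
\<close>

definition prepend :: "real \<Rightarrow> 'u \<Rightarrow> (real \<Rightarrow> 'u) \<Rightarrow> real \<Rightarrow> 'u" where
  "prepend h a u t = (if t - h \<in> {0..} then u (t - h) else a)"

lemma prepend_control:
  assumes u: "u \<in> controls U" and a: "a \<in> U"
  shows "prepend h a u \<in> controls U"
proof -
  have "(\<lambda>s. if s \<in> {0..} then u s else a) \<in> lebesgue \<rightarrow>\<^sub>M restrict_space borel U"
    using u a by (subst measurable_restrict_space_iff[symmetric])
      (auto simp: controls_def space_restrict_space)
  moreover have "(\<lambda>t. t - h) \<in> lebesgue \<rightarrow>\<^sub>M lebesgue"
    using lebesgue_affine_measurable[of "\<lambda>_. 1" "- h :: real"] by simp
  ultimately have "prepend h a u \<in> lebesgue \<rightarrow>\<^sub>M restrict_space borel U"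
    unfolding prepend_def by (rule measurable_compose[rotated])
  then show ?thesis
    unfolding controls_def by (rule measurable_restrict_space1)
qed

lemma const_control: "a \<in> U \<Longrightarrow> (\<lambda>_. a) \<in> controls U"
  by (auto simp: controls_def space_restrict_space)

section \<open>Existence, uniqueness and concatenation of trajectories\<close>

lemma continuous_on_halfline:
  fixes y :: "real \<Rightarrow> 'a::topological_space"
  assumes "\<And>t. 0 \<le> t \<Longrightarrow> continuous_on {0..t} y"
  shows "continuous_on {0..} y"
  unfolding continuous_on_eq_continuous_within
proof
  fix t :: real assume t: "t \<in> {0..}"
  have "at t within {0..} = at t within {0..t+1}"
    by (rule at_within_nhd[where S="{..<t+1}"]) auto
  then show "continuous (at t within {0..}) y"
    using assms[of "t+1"] t by (auto simp: continuous_on_eq_continuous_within)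
qed

text \<open>
  The gain of a factor \<open>1 / \<kappa>\<close> is what turns the Picard operator into a contraction in the norm weighted
  by \<open>exp (- \<kappa> * t)\<close> on the whole half-line.
\<close>

lemma exp_weighted_integral_bound:
  fixes G :: "real \<Rightarrow> 'a::euclidean_space"
  assumes G: "G integrable_on {0..\<tau>}" and lam: "0 < \<kappa>" and c: "0 \<le> c" and \<tau>: "0 \<le> \<tau>"
    and le: "\<And>s. s \<in> {0..\<tau>} \<Longrightarrow> norm (G s) \<le> c * exp (\<kappa> * s)"
  shows "exp (- \<kappa> * \<tau>) * norm (integral {0..\<tau>} G) \<le> c / \<kappa>"
proof -
  have I: "((\<lambda>s. c * exp (\<kappa> * s)) has_integral (c / \<kappa> * exp (\<kappa> * \<tau>) - c / \<kappa> * exp (\<kappa> * 0))) {0..\<tau>}"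
    using lam \<tau> by (intro fundamental_theorem_of_calculus)
      (auto intro!: derivative_eq_intros simp flip: has_real_derivative_iff_has_vector_derivative)
  have "norm (integral {0..\<tau>} G) \<le> integral {0..\<tau>} (\<lambda>s. c * exp (\<kappa> * s))"
    using le by (intro integral_norm_bound_integral G has_integral_integrable[OF I]) auto
  also have "\<dots> \<le> c / \<kappa> * exp (\<kappa> * \<tau>)"
    unfolding integral_unique[OF I] using c lam by simp
  finally have "exp (- \<kappa> * \<tau>) * norm (integral {0..\<tau>} G) \<le> exp (- \<kappa> * \<tau>) * (c / \<kappa> * exp (\<kappa> * \<tau>))"
    by (intro mult_left_mono) auto
  also have "\<dots> = c / \<kappa>" by (simp add: exp_minus)
  finally show ?thesis .
qed

locale control_system =
  fixes U :: "'u::metric_space set" and f :: "(real^'m) \<times> 'u \<Rightarrow> real^'m" and L :: real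
  assumes compact_U: "compact U"
    and cont_f: "continuous_on (UNIV \<times> U) f"
    and lipschitz_f: "\<And>u. u \<in> U \<Longrightarrow> L-lipschitz_on UNIV (\<lambda>y. f (y, u))"
begin

lemma f_lipschitz: "u \<in> U \<Longrightarrow> norm (f (y, u) - f (z, u)) \<le> L * norm (y - z)"
  using lipschitz_f[of u] by (auto simp: lipschitz_on_def dist_norm)

lemma L_nonneg: "u \<in> U \<Longrightarrow> 0 \<le> L"
  using lipschitz_f lipschitz_on_nonneg by blast

lemma velocity_integrable:
  assumes "u \<in> controls U" "continuous_on {a..b} y" "0 \<le> a"
  shows "(\<lambda>s. f (y s, u s)) absolutely_integrable_on {a..b}"
  using control_integrable[OF assms(1,2,3) subset_UNIV compact_U cont_f] .

lemma solution_iff: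
  assumes u: "u \<in> controls U"
  shows "is_solution f u x y \<longleftrightarrow>
    continuous_on {0..} y \<and> (\<forall>t\<ge>0. y t = x + integral {0..t} (\<lambda>s. f (y s, u s)))"
proof (intro iffI conjI)
  assume S: "is_solution f u x y"
  then have int: "(\<lambda>s. f (y s, u s)) absolutely_integrable_on {0..t}"
    and eq: "y t = x + integral {0..t} (\<lambda>s. f (y s, u s))" if "0 \<le> t" for t
    using that by (auto simp: is_solution_def set_lebesgue_integral_eq_integral)
  show "\<forall>t\<ge>0. y t = x + integral {0..t} (\<lambda>s. f (y s, u s))" using eq by blast
  show "continuous_on {0..} y"
  proof (rule continuous_on_halfline)
    fix t :: real assume t: "0 \<le> t"
    have "continuous_on {0..t} (\<lambda>t. x + integral {0..t} (\<lambda>s. f (y s, u s)))"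
      by (intro continuous_intros indefinite_integral_continuous_1
          absolutely_integrable_imp_integrable int[OF t])
    then show "continuous_on {0..t} y"
      by (rule continuous_on_eq) (auto simp: eq)
  qed
next
  assume S: "continuous_on {0..} y \<and> (\<forall>t\<ge>0. y t = x + integral {0..t} (\<lambda>s. f (y s, u s)))"
  have "(\<lambda>s. f (y s, u s)) absolutely_integrable_on {0..t}" for t
    using S by (intro velocity_integrable u) (auto intro: continuous_on_subset)
  then show "is_solution f u x y"
    using S by (simp add: is_solution_def set_lebesgue_integral_eq_integral)
qed

lemma solution_continuous:
  assumes u: "u \<in> controls U" and y: "is_solution f u x y" and a: "0 \<le> a"
  shows "continuous_on {a..b} y"
proof -
  from y[unfolded solution_iff[OF u]] have "continuous_on {0..} y" by (rule conjunct1)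
  then show ?thesis by (rule continuous_on_subset) (use a in auto)
qed

lemma solution_eq:
  assumes u: "u \<in> controls U" and y: "is_solution f u x y" and t: "0 \<le> t"
  shows "y t = x + integral {0..t} (\<lambda>s. f (y s, u s))"
  using conjunct2[OF y[unfolded solution_iff[OF u]]] t by blast

text \<open>
  The Picard operator is conjugated with the weight: a solution is sought as \<open>y t = exp (\<kappa> * t) w t\<close> with
  \<open>w\<close> bounded and continuous. For \<open>\<kappa> = L + 1\<close> the conjugated operator \<open>P\<close> has Lipschitz constant \<open>L / \<kappa> < 1\<close>.
  Negative times are irrelevant and are frozen by \<open>max 0 t\<close> because the space of bounded continuous
  functions lives on the whole line.
\<close>

lemma solution_exists:
  assumes u: "u \<in> controls U"
  shows "\<exists>y. is_solution f u x y"
proof -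
  have L: "0 \<le> L" using L_nonneg control_in[OF u, of 0] by simp
  define \<kappa> where "\<kappa> = L + 1"
  have lam: "0 < \<kappa>" using L by (simp add: \<kappa>_def)
  have "compact ((\<lambda>u. f (0, u)) ` U)"
    by (intro compact_continuous_image compact_U continuous_on_compose2[OF cont_f] continuous_intros) auto
  then obtain M where "\<forall>x\<in>(\<lambda>u. f (0, u)) ` U. norm x \<le> M"
    using compact_imp_bounded bounded_iff by metis
  then have M: "\<And>u. u \<in> U \<Longrightarrow> norm (f (0, u)) \<le> M" by blast
  have M0: "0 \<le> M" by (rule order_trans[OF norm_ge_zero M[OF control_in[OF u order_refl]]])
  define g where "g w s = f (exp (\<kappa> * s) *\<^sub>R apply_bcontfun w s, u s)" for w :: "real \<Rightarrow>\<^sub>C (real^'m)" and s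
  define P where "P w t = exp (- \<kappa> * max 0 t) *\<^sub>R (x + integral {0..max 0 t} (g w))" for w t
  have g_int: "g w integrable_on {0..t}" for w t
    unfolding g_def by (intro absolutely_integrable_imp_integrable velocity_integrable u continuous_intros) auto
  have g_lip: "norm (g w s - g v s) \<le> L * dist w v * exp (\<kappa> * s)" if "0 \<le> s" for w v s
  proof -
    have "norm (g w s - g v s) \<le> L * norm (exp (\<kappa> * s) *\<^sub>R (apply_bcontfun w s - apply_bcontfun v s))"
      using f_lipschitz[OF control_in[OF u that], of "exp (\<kappa> * s) *\<^sub>R apply_bcontfun w s" "exp (\<kappa> * s) *\<^sub>R apply_bcontfun v s"]
      unfolding g_def scaleR_diff_right .
    also have "\<dots> = L * (exp (\<kappa> * s) * dist (apply_bcontfun w s) (apply_bcontfun v s))"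
      by (simp add: dist_norm)
    also have "\<dots> \<le> L * (exp (\<kappa> * s) * dist w v)"
      by (intro mult_left_mono dist_bounded L) auto
    finally show ?thesis by (simp add: mult_ac)
  qed
  have P_bcont: "P w \<in> bcontfun" for w
  proof -
    have "continuous_on {0..t} (\<lambda>t. integral {0..t} (g w))" for t
      by (intro indefinite_integral_continuous_1 g_int)
    then have "continuous_on {0..} (\<lambda>t. integral {0..t} (g w))"
      by (intro continuous_on_halfline)
    then have "continuous_on UNIV (\<lambda>t. integral {0..max 0 t} (g w))"
      by (rule continuous_on_compose2) (auto intro!: continuous_intros)
    then have "continuous_on UNIV (P w)"
      unfolding P_def by (intro continuous_intros)
    moreover have "norm (P w t) \<le> norm x + (M + L * dist w 0) / \<kappa>" for t
    proof -
      have "norm (g w s) \<le> (M + L * dist w 0) * exp (\<kappa> * s)" if "s \<in> {0..max 0 t}" for s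
      proof -
        have s: "0 \<le> s" using that by simp
        have "norm (g 0 s) \<le> M" using M control_in[OF u s] by (simp add: g_def)
        also have "M \<le> M * exp (\<kappa> * s)" using M0 lam s by (intro mult_le_cancel_left1[THEN iffD2]) auto
        finally show ?thesis
          using g_lip[OF s, of w 0] norm_triangle_ineq2[of "g w s" "g 0 s"] by (simp add: algebra_simps)
      qed
      then have "exp (- \<kappa> * max 0 t) * norm (integral {0..max 0 t} (g w)) \<le> (M + L * dist w 0) / \<kappa>"
        using lam M0 L by (intro exp_weighted_integral_bound g_int) auto
      moreover have "exp (- \<kappa> * max 0 t) * norm x \<le> norm x"
        using lam by (intro mult_left_le_one_le) auto
      moreover have "norm (P w t) \<le> exp (- \<kappa> * max 0 t) * norm x
          + exp (- \<kappa> * max 0 t) * norm (integral {0..max 0 t} (g w))"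
        unfolding P_def norm_scaleR abs_exp_cancel distrib_left[symmetric]
        by (intro mult_left_mono norm_triangle_ineq) auto
      ultimately show ?thesis by linarith
    qed
    ultimately show ?thesis by (auto simp: bcontfun_def bounded_iff)
  qed
  have P_app: "apply_bcontfun (Bcontfun (P w)) = P w" for w
    using P_bcont by (rule Bcontfun_inverse)
  have "dist (Bcontfun (P w)) (Bcontfun (P v)) \<le> (L / \<kappa>) * dist w v" for w v
  proof (rule dist_bound, unfold P_app)
    fix t
    have "dist (P w t) (P v t)
        = exp (- \<kappa> * max 0 t) * norm (integral {0..max 0 t} (g w) - integral {0..max 0 t} (g v))"
      by (simp add: P_def dist_norm flip: scaleR_diff_right)
    also have "integral {0..max 0 t} (g w) - integral {0..max 0 t} (g v)
        = integral {0..max 0 t} (\<lambda>s. g w s - g v s)"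
      by (simp add: integral_diff g_int)
    also have "exp (- \<kappa> * max 0 t) * norm \<dots> \<le> (L * dist w v) / \<kappa>"
      using lam L g_lip by (intro exp_weighted_integral_bound integrable_diff g_int) auto
    finally show "dist (P w t) (P v t) \<le> L / \<kappa> * dist w v" by simp
  qed
  then obtain w where w: "Bcontfun (P w) = w"
    using banach_fix_type[of "L / \<kappa>" "\<lambda>w. Bcontfun (P w)"] L lam by (auto simp: \<kappa>_def)
  define y where "y t = exp (\<kappa> * t) *\<^sub>R apply_bcontfun w t" for t
  have "is_solution f u x y"
    unfolding solution_iff[OF u]
  proof (intro conjI allI impI)
    show "continuous_on {0..} y" unfolding y_def by (intro continuous_intros) auto
    fix t :: real assume t: "0 \<le> t"
    have "apply_bcontfun w t = P w t" using w P_app by metis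
    then show "y t = x + integral {0..t} (\<lambda>s. f (y s, u s))"
      using t by (simp add: y_def P_def g_def[abs_def] flip: exp_add)
  qed
  then show ?thesis by (rule exI[where x=y])
qed

lemma traj_solution: "u \<in> controls U \<Longrightarrow> is_solution f u x (traj f x u)"
  unfolding traj_def by (rule someI_ex[OF solution_exists])

lemma traj_continuous:
  "u \<in> controls U \<Longrightarrow> 0 \<le> a \<Longrightarrow> continuous_on {a..b} (traj f x u)"
  by (rule solution_continuous[OF _ traj_solution])

lemma traj_eq: "u \<in> controls U \<Longrightarrow> 0 \<le> t
    \<Longrightarrow> traj f x u t = x + integral {0..t} (\<lambda>s. f (traj f x u s, u s))"
  by (rule solution_eq[OF _ traj_solution])

lemma traj_velocity_integrable:
  "u \<in> controls U \<Longrightarrow> 0 \<le> a \<Longrightarrow> (\<lambda>s. f (traj f x u s, u s)) integrable_on {a..b}"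
  by (intro absolutely_integrable_imp_integrable velocity_integrable traj_continuous)

lemma traj_0: "u \<in> controls U \<Longrightarrow> traj f x u 0 = x"
  using traj_eq[of u 0 x] by simp

lemma traj_increment:
  assumes u: "u \<in> controls U" and "0 \<le> s" "s \<le> t"
  shows "traj f x u t - traj f x u s = integral {s..t} (\<lambda>s. f (traj f x u s, u s))"
proof -
  have "integral {0..s} (\<lambda>s. f (traj f x u s, u s)) + integral {s..t} (\<lambda>s. f (traj f x u s, u s))
      = integral {0..t} (\<lambda>s. f (traj f x u s, u s))"
    by (rule Henstock_Kurzweil_Integration.integral_combine[OF assms(2,3)
          traj_velocity_integrable[OF u order_refl]])
  moreover have "0 \<le> t" using assms by simp
  ultimately show ?thesis
    using traj_eq[OF u \<open>0 \<le> s\<close>, of x] traj_eq[OF u \<open>0 \<le> t\<close>, of x] by (simp add: algebra_simps)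
qed

text \<open>
  The two controls need only agree up to time \<open>T\<close>, so that the same estimate gives continuous dependence
  on the initial point and, for equal initial points, local uniqueness.
\<close>

lemma solution_dependence:
  assumes u: "u \<in> controls U" and y: "is_solution f u x y"
    and v: "v \<in> controls U" and z: "is_solution f v x' z"
    and uv: "\<And>s. 0 \<le> s \<Longrightarrow> s < T \<Longrightarrow> u s = v s" and t: "t \<in> {0..T}"
  shows "norm (y t - z t) \<le> norm (x - x') * exp (L * t)"
proof (rule gronwall_integral[where w="\<lambda>t. norm (y t - z t)" and t=T])
  note y' = solution_continuous[OF u y order_refl] and yeq = solution_eq[OF u y]
    and z' = solution_continuous[OF v z order_refl] and zeq = solution_eq[OF v z]
  show cont: "continuous_on {0..T} (\<lambda>t. norm (y t - z t))"
    by (intro continuous_intros y' z')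
  show "0 \<le> L" using L_nonneg control_in[OF u, of 0] by simp
  show "t \<in> {0..T}" by fact
  fix s assume s: "s \<in> {0..T}"
  have fy: "(\<lambda>r. f (y r, u r)) integrable_on {0..s}" and fz: "(\<lambda>r. f (z r, u r)) integrable_on {0..s}"
    by (intro absolutely_integrable_imp_integrable velocity_integrable u y' z' order_refl)+
  have "integral {0..s} (\<lambda>r. f (z r, v r)) = integral {0..s} (\<lambda>r. f (z r, u r))"
    by (rule integral_spike[of "{T}"]) (use s uv in auto)
  then have "y s - z s = (x - x') + integral {0..s} (\<lambda>r. f (y r, u r) - f (z r, u r))"
    using yeq[of s] zeq[of s] s by (simp add: integral_diff fy fz)
  also have "norm \<dots> \<le> norm (x - x') + norm (integral {0..s} (\<lambda>r. f (y r, u r) - f (z r, u r)))"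
    by (rule norm_triangle_ineq)
  also have "norm (integral {0..s} (\<lambda>r. f (y r, u r) - f (z r, u r)))
      \<le> integral {0..s} (\<lambda>r. L * norm (y r - z r))"
    using s control_in[OF u]
    by (intro integral_norm_bound_integral integrable_diff fy fz integrable_continuous_real
        continuous_intros y' z' f_lipschitz) auto
  finally show "norm (y s - z s) \<le> norm (x - x') + L * integral {0..s} (\<lambda>r. norm (y r - z r))"
    by simp
qed

lemma traj_dependence:
  assumes "u \<in> controls U" "0 \<le> t"
  shows "norm (traj f x u t - traj f x' u t) \<le> norm (x - x') * exp (L * t)"
  by (rule solution_dependence[OF assms(1) traj_solution[OF assms(1)] assms(1) traj_solution[OF assms(1)],
        where T=t]) (use assms in auto)

lemma solution_unique:
  assumes "u \<in> controls U" "is_solution f u x y" "v \<in> controls U" "is_solution f v x z"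
    "\<And>s. 0 \<le> s \<Longrightarrow> s < T \<Longrightarrow> u s = v s" "t \<in> {0..T}"
  shows "y t = z t"
  using solution_dependence[OF assms] by simp

lemma traj_prepend_before:
  assumes u: "u \<in> controls U" and a: "a \<in> U" and t: "t \<in> {0..h}"
  shows "traj f x (prepend h a u) t = traj f x (\<lambda>_. a) t"
proof (rule solution_unique)
  show v: "prepend h a u \<in> controls U" and c: "(\<lambda>_. a) \<in> controls U"
    by (rule prepend_control[OF u a], rule const_control[OF a])
  show "is_solution f (prepend h a u) x (traj f x (prepend h a u))" by (rule traj_solution[OF v])
  show "is_solution f (\<lambda>_. a) x (traj f x (\<lambda>_. a))" by (rule traj_solution[OF c])
  show "t \<in> {0..h}" by (rule t)
qed (simp add: prepend_def)

lemma traj_prepend_after: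
  assumes u: "u \<in> controls U" and a: "a \<in> U" and h: "0 \<le> h" and s: "0 \<le> s"
  shows "traj f x (prepend h a u) (h + s) = traj f (traj f x (\<lambda>_. a) h) u s"
proof -
  let ?v = "prepend h a u" let ?y = "traj f x ?v" let ?p = "traj f x (\<lambda>_. a) h"
  have v: "?v \<in> controls U" by (rule prepend_control[OF u a])
  have p: "?p = ?y h" by (rule traj_prepend_before[OF u a, symmetric]) (use h in auto)
  have "is_solution f u ?p (\<lambda>s. ?y (h + s))"
    unfolding solution_iff[OF u]
  proof (intro conjI allI impI)
    show "continuous_on {0..} (\<lambda>s. ?y (h + s))"
    proof (rule continuous_on_halfline)
      fix t :: real
      show "continuous_on {0..t} (\<lambda>s. ?y (h + s))"
        by (rule continuous_on_compose2[OF traj_continuous[OF v order_refl, where b="h + t"]])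
          (use h in \<open>auto intro!: continuous_intros\<close>)
    qed
    fix t :: real assume t: "0 \<le> t"
    have "?y (h + t) - ?y h = integral {h..h + t} (\<lambda>s. f (?y s, ?v s))"
      using traj_increment[OF v, of h "h + t"] h t by simp
    also have "\<dots> = integral {0..t} (\<lambda>s. f (?y (h + s), ?v (h + s)))"
      using integral_shift_Icc_real[of 0 t "\<lambda>s. f (?y s, ?v s)" h] by (simp add: o_def add.commute)
    also have "\<dots> = integral {0..t} (\<lambda>s. f (?y (h + s), u s))"
      by (rule integral_cong) (simp add: prepend_def)
    finally show "?y (h + t) = ?p + integral {0..t} (\<lambda>s. f (?y (h + s), u s))"
      by (simp add: p algebra_simps)
  qed
  then show ?thesis
    by (rule solution_unique[OF u _ u traj_solution[OF u], where T=s]) (use s in auto)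
qed

end

section \<open>Continuously differentiable functions and their values along trajectories\<close>

lemma GDERIV_unique:
  assumes "GDERIV \<phi> y :> D" and "GDERIV \<phi> y :> E"
  shows "D = E"
proof -
  have "(\<lambda>h. h \<bullet> D) = (\<lambda>h. h \<bullet> E)"
    using assms unfolding gderiv_def by (rule has_derivative_unique)
  then have "(D - E) \<bullet> D = (D - E) \<bullet> E" by meson
  then have "(D - E) \<bullet> (D - E) = 0" by (simp add: inner_diff_right)
  then show ?thesis by simp
qed

lemma gradient_eq: "GDERIV \<phi> y :> D \<Longrightarrow> gradient \<phi> y = D"
  unfolding gradient_def by (rule the_equality) (auto intro: GDERIV_unique)

lemma C1_I:
  assumes "\<And>y. GDERIV \<phi> y :> G y" and "continuous_on UNIV G"
  shows "\<phi> \<in> C1"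
  using assms gradient_eq[OF assms(1)] by (auto simp: C1_def cong: continuous_on_cong)

lemma C1_GDERIV: "\<phi> \<in> C1 \<Longrightarrow> GDERIV \<phi> y :> gradient \<phi> y"
  using gradient_eq by (force simp: C1_def)

lemma C1_continuous_gradient: "\<phi> \<in> C1 \<Longrightarrow> continuous_on S (gradient \<phi>)"
  by (auto simp: C1_def elim: continuous_on_subset)

lemma C1_continuous: "\<phi> \<in> C1 \<Longrightarrow> continuous_on S \<phi>"
  using C1_GDERIV[unfolded gderiv_def] has_derivative_continuous
  by (metis continuous_at_imp_continuous_on)

context control_system
begin

lemma gradient_flow_continuous:
  "\<phi> \<in> C1 \<Longrightarrow> continuous_on (UNIV \<times> U) (\<lambda>z. gradient \<phi> (fst z) \<bullet> f z)"
  by (intro continuous_on_inner cont_f continuous_on_compose2[OF C1_continuous_gradient[of \<phi> UNIV]]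
      continuous_intros) auto

text \<open>
  Chain rule for the Caratheodory solutions. Near each \<open>t\<close> both \<open>\<phi> (y b) - \<phi> (y a)\<close> and the integral are
  compared with the increment of \<open>y\<close> paired with the fixed vector \<open>gradient \<phi> (y t)\<close>; since \<open>y\<close> is
  Lipschitz on compact intervals, both errors are \<open>o(b - a)\<close>.
\<close>

lemma C1_along_traj:
  assumes phi: "\<phi> \<in> C1" and u: "u \<in> controls U" and T: "0 \<le> T"
  shows "\<phi> (traj f x u T) = \<phi> x + integral {0..T} (\<lambda>s. gradient \<phi> (traj f x u s) \<bullet> f (traj f x u s, u s))"
proof -
  let ?y = "traj f x u" and ?v = "\<lambda>s. f (traj f x u s, u s)"
  let ?G = "\<lambda>s. gradient \<phi> (?y s) \<bullet> ?v s"
  have y: "continuous_on {0..T} ?y" by (rule traj_continuous[OF u order_refl])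
  have G: "?G integrable_on {a..b}" if "0 \<le> a" for a b
    using control_integrable[OF u traj_continuous[OF u that, where x=x] that subset_UNIV compact_U
        gradient_flow_continuous[OF phi]]
    by (auto intro: absolutely_integrable_imp_integrable)
  have "compact (?y ` {0..T} \<times> U)" using y by (intro compact_Times compact_continuous_image compact_U) auto
  then obtain M where M: "0 \<le> M" "\<And>z. z \<in> ?y ` {0..T} \<times> U \<Longrightarrow> norm (f z) \<le> M"
    using continuous_bounded_on_compact continuous_on_subset[OF cont_f] by (metis Sigma_mono order_refl subset_UNIV)
  have vM: "norm (?v s) \<le> M" if "s \<in> {0..T}" for s
    using that control_in[OF u] by (intro M(2)) auto
  have y_lip: "norm (?y b - ?y a) \<le> M * (b - a)" if "0 \<le> a" "a \<le> b" "b \<le> T" for a b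
    unfolding traj_increment[OF u that(1,2)]
    by (rule norm_integral_le) (use that vM M traj_velocity_integrable[OF u] in auto)
  define F where "F t = \<phi> (?y t) - integral {0..t} ?G" for t
  have "F T = F 0"
  proof (rule constant_if_increment_small[OF T])
    fix t e :: real assume t: "t \<in> {0..T}" and e: "0 < e"
    \<comment> \<open>The two linearisation errors are each at most \<open>e' * M * (b - a)\<close>; the summand \<open>1\<close> covers \<open>M = 0\<close>.\<close>
    define e' where "e' = e / (2 * M + 1)"
    have e': "0 < e'" "e' * (2 * M + 1) = e" using e M(1) by (auto simp: e'_def add_nonneg_pos intro!: divide_pos_pos)
    let ?D = "gradient \<phi> (?y t)"
    have "(\<phi> has_derivative (\<lambda>h. h \<bullet> ?D)) (at (?y t))"
      using C1_GDERIV[OF phi] by (simp add: gderiv_def)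
    then obtain r where r: "0 < r"
      "\<And>z. norm (z - ?y t) < r \<Longrightarrow> \<bar>\<phi> z - \<phi> (?y t) - (z - ?y t) \<bullet> ?D\<bar> \<le> e' * norm (z - ?y t)"
      using e'(1) unfolding has_derivative_within_alt by auto
    have "isCont (gradient \<phi>) (?y t)"
      using C1_continuous_gradient[OF phi, of UNIV] by (simp add: continuous_on_eq_continuous_at)
    then obtain q where q: "0 < q" "\<And>z. dist z (?y t) < q \<Longrightarrow> dist (gradient \<phi> z) ?D < e'"
      using e'(1) unfolding continuous_at_eps_delta by blast
    have "M + 1 > 0" using M by simp
    show "\<exists>d>0. \<forall>a b. 0 \<le> a \<longrightarrow> a \<le> b \<longrightarrow> b \<le> T \<longrightarrow> b - a < d \<longrightarrow> t = a \<or> t = b \<longrightarrow>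
        \<bar>F b - F a\<bar> \<le> e * (b - a)"
    proof (intro exI[of _ "min r q / (M + 1)"] conjI allI impI)
      show "0 < min r q / (M + 1)" using r q \<open>M + 1 > 0\<close> by simp
      fix a b assume ab: "0 \<le> a" "a \<le> b" "b \<le> T" and d: "b - a < min r q / (M + 1)" and tab: "t = a \<or> t = b"
      have "(b - a) * (M + 1) < min r q" using d \<open>M + 1 > 0\<close> by (simp add: pos_less_divide_eq)
      then have small: "M * (b - a) < min r q" using ab by (simp add: algebra_simps)
      have near: "norm (?y s - ?y t) \<le> M * (b - a)" if s: "s \<in> {a..b}" for s
      proof (cases "s \<le> t")
        case True
        have "norm (?y t - ?y s) \<le> M * (t - s)" using True s t ab by (intro y_lip) auto
        also have "\<dots> \<le> M * (b - a)" using s tab ab M(1) by (intro mult_left_mono) auto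
        finally show ?thesis by (simp add: norm_minus_commute)
      next
        case False
        have "norm (?y s - ?y t) \<le> M * (s - t)" using False s t ab by (intro y_lip) auto
        also have "\<dots> \<le> M * (b - a)" using s tab ab M(1) by (intro mult_left_mono) auto
        finally show ?thesis .
      qed
      have lin: "\<bar>\<phi> (?y b) - \<phi> (?y a) - (?y b - ?y a) \<bullet> ?D\<bar> \<le> e' * (M * (b - a))"
      proof -
        have *: "\<bar>\<phi> (?y s) - \<phi> (?y t) - (?y s - ?y t) \<bullet> ?D\<bar> \<le> e' * (M * (b - a))" if s: "s \<in> {a..b}" for s
        proof -
          have "norm (?y s - ?y t) < r" using near[OF s] small by linarith
          from r(2)[OF this] show ?thesis
            using near[OF s] e'(1) by (meson mult_left_mono less_imp_le order_trans)
        qed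
        from tab show ?thesis
        proof
          assume "t = a" then show ?thesis using *[of b] ab by simp
        next
          assume "t = b" then show ?thesis using *[of a] ab by (simp add: inner_diff_left abs_le_iff)
        qed
      qed
      have vint: "(\<lambda>s. ?v s \<bullet> ?D) integrable_on {a..b}"
        using integrable_linear[OF traj_velocity_integrable[OF u ab(1)] bounded_linear_inner_left] by (simp add: o_def)
      have "(?y b - ?y a) \<bullet> ?D = integral {a..b} (\<lambda>s. ?v s \<bullet> ?D)"
        unfolding traj_increment[OF u ab(1,2)]
        using integral_linear[OF traj_velocity_integrable[OF u ab(1)] bounded_linear_inner_left] by (simp add: o_def)
      moreover have "integral {0..b} ?G - integral {0..a} ?G = integral {a..b} ?G"
        using Henstock_Kurzweil_Integration.integral_combine[of 0 a b ?G] ab G[of 0] by simp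
      ultimately have "F b - F a = (\<phi> (?y b) - \<phi> (?y a) - (?y b - ?y a) \<bullet> ?D)
          - integral {a..b} (\<lambda>s. ?G s - ?v s \<bullet> ?D)"
        using G[OF ab(1)] vint by (simp add: F_def integral_diff)
      moreover have "norm (integral {a..b} (\<lambda>s. ?G s - ?v s \<bullet> ?D)) \<le> (e' * M) * (b - a)"
      proof (rule norm_integral_le)
        show "(\<lambda>s. ?G s - ?v s \<bullet> ?D) integrable_on {a..b}" using G[OF ab(1)] vint by (rule integrable_diff)
        fix s assume s: "s \<in> {a..b}"
        have "?G s - ?v s \<bullet> ?D = (gradient \<phi> (?y s) - ?D) \<bullet> ?v s"
          unfolding inner_commute[of "?v s" ?D] by (rule inner_diff_left[symmetric])
        also have "norm \<dots> \<le> norm (gradient \<phi> (?y s) - ?D) * norm (?v s)"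
          unfolding real_norm_def by (rule Cauchy_Schwarz_ineq2)
        also have "\<dots> \<le> e' * M"
        proof (rule mult_mono)
          have "dist (?y s) (?y t) < q" using near[OF s] small by (simp add: dist_norm)
          from q(2)[OF this] show "norm (gradient \<phi> (?y s) - ?D) \<le> e'" by (simp add: dist_norm)
          show "norm (?v s) \<le> M" using s ab by (intro vM) auto
        qed (use e' in auto)
        finally show "norm (?G s - ?v s \<bullet> ?D) \<le> e' * M" .
      qed (use ab e' M in auto)
      ultimately have "\<bar>F b - F a\<bar> \<le> e' * (2 * M) * (b - a)"
        using lin by (simp add: abs_le_iff algebra_simps)
      also have "\<dots> \<le> e' * (2 * M + 1) * (b - a)"
        using e' ab by (intro mult_right_mono mult_left_mono) auto
      finally show "\<bar>F b - F a\<bar> \<le> e * (b - a)" by (simp only: e'(2))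
    qed
  qed
  then show ?thesis by (simp add: F_def traj_0[OF u])
qed

end

section \<open>Mollification of one-sided inequalities\<close>

text \<open>
  The simplest compactly supported function that is just smooth enough: squaring the positive part
  makes it \<open>C1\<close> with support in the ball of radius \<open>r\<close>. It is not normalised.
\<close>

definition bump :: "real \<Rightarrow> 'a::real_inner \<Rightarrow> real" where
  "bump r z = (max 0 (r\<^sup>2 - z \<bullet> z))\<^sup>2"

definition bump_gradient :: "real \<Rightarrow> 'a::real_inner \<Rightarrow> 'a" where
  "bump_gradient r z = (- 4 * max 0 (r\<^sup>2 - z \<bullet> z)) *\<^sub>R z"

lemma bump_nonneg: "0 \<le> bump r z" and bump_minus: "bump r (- z) = bump r z"
  by (simp_all add: bump_def)

lemma bump_eq_0: "0 \<le> r \<Longrightarrow> r \<le> norm z \<Longrightarrow> bump r z = 0"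
  by (simp add: bump_def max_def flip: power2_norm_eq_inner)

lemma continuous_on_bump [continuous_intros]:
  "continuous_on S g \<Longrightarrow> continuous_on S (\<lambda>x. bump r (g x))"
  unfolding bump_def by (intro continuous_intros)

lemma continuous_on_bump_gradient [continuous_intros]:
  "continuous_on S g \<Longrightarrow> continuous_on S (\<lambda>x. bump_gradient r (g x))"
  unfolding bump_gradient_def by (intro continuous_intros)

lemma DERIV_pos_part_square: "DERIV (\<lambda>x::real. (max 0 x)\<^sup>2) x :> 2 * max 0 x"
proof (cases x "0::real" rule: linorder_cases)
  case less
  have "DERIV (\<lambda>_. 0) x :> 2 * max 0 x" using less by simp
  then show ?thesis
    by (rule has_field_derivative_transform_within_open[where S="{..<0}"]) (use less in auto)
next
  case greater
  have "DERIV (\<lambda>x. x\<^sup>2) x :> 2 * max 0 x" using greater by (auto intro!: derivative_eq_intros)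
  then show ?thesis
    by (rule has_field_derivative_transform_within_open[where S="{0<..}"]) (use greater in auto)
next
  case equal
  have "(\<lambda>h::real. (max 0 h)\<^sup>2 / h) \<midarrow>0\<rightarrow> 0"
  proof (rule Lim_null_comparison)
    show "\<forall>\<^sub>F h in at 0. norm ((max 0 h)\<^sup>2 / h) \<le> \<bar>h\<bar>"
      by (intro always_eventually) (auto simp: max_def power2_eq_square)
    show "(\<lambda>h::real. \<bar>h\<bar>) \<midarrow>0\<rightarrow> 0" by (intro tendsto_rabs_zero tendsto_ident_at)
  qed
  then show ?thesis using equal by (simp add: DERIV_def)
qed

lemma GDERIV_bump: "GDERIV (bump r) z :> bump_gradient r z"
proof -
  have "GDERIV (\<lambda>z. r\<^sup>2 - z \<bullet> z) z :> - (2 *\<^sub>R z)"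
    unfolding gderiv_def by (auto intro!: derivative_eq_intros simp: inner_commute)
  then have "GDERIV (\<lambda>z. (max 0 (r\<^sup>2 - z \<bullet> z))\<^sup>2) z :> (2 * max 0 (r\<^sup>2 - z \<bullet> z)) *\<^sub>R - (2 *\<^sub>R z)"
    by (rule GDERIV_DERIV_compose) (rule DERIV_pos_part_square)
  then show ?thesis by (simp add: bump_def[abs_def] bump_gradient_def)
qed

lemma mollification_C1:
  fixes g :: "real^'m \<Rightarrow> real"
  assumes g: "continuous_on UNIV g"
  shows "(\<lambda>y. integral (cbox a b) (\<lambda>w. g w * bump r (y - w))) \<in> C1"
proof (rule C1_I)
  let ?D = "\<lambda>y w. g w *\<^sub>R bump_gradient r (y - w)"
  have contD: "continuous_on (UNIV \<times> cbox a b) (\<lambda>(y, w). ?D y w)"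
    unfolding split_def by (intro continuous_intros continuous_on_compose2[OF g]) auto
  then show "continuous_on UNIV (\<lambda>y. integral (cbox a b) (?D y))"
    by (rule integral_continuous_on_param)
  fix y
  have "((\<lambda>y. integral (cbox a b) (\<lambda>w. g w * bump r (y - w))) has_derivative
      integral (cbox a b) (\<lambda>w. blinfun_inner_left (?D y w))) (at y within UNIV)"
  proof (rule leibniz_rule[where fx="\<lambda>y w. blinfun_inner_left (?D y w)"])
    fix y w :: "real^'m"
    have "((\<lambda>y. y - w) has_derivative (\<lambda>h. h)) (at y)" by (auto intro!: derivative_eq_intros)
    from has_derivative_compose[OF this GDERIV_bump[unfolded gderiv_def, of r "y - w"]]
    have "((\<lambda>y. bump r (y - w)) has_derivative (\<lambda>h. h \<bullet> bump_gradient r (y - w))) (at y)" .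
    from has_derivative_mult_right[OF this, of "g w"]
    show "((\<lambda>y. g w * bump r (y - w)) has_derivative blinfun_apply (blinfun_inner_left (?D y w)))
        (at y within UNIV)"
      by (simp add: blinfun_inner_left.rep_eq)
  next
    show "(\<lambda>w. g w * bump r (y - w)) integrable_on cbox a b" for y
      by (intro integrable_continuous continuous_intros continuous_on_subset[OF g]) auto
    show "continuous_on (UNIV \<times> cbox a b) (\<lambda>(y, w). blinfun_inner_left (?D y w))"
      using bounded_linear.continuous_on[OF bounded_linear_blinfun_inner_left contD]
      by (simp add: split_def)
  qed auto
  moreover have "integral (cbox a b) (\<lambda>w. blinfun_inner_left (?D y w))
      = blinfun_inner_left (integral (cbox a b) (?D y))"
    using integral_linear[OF _ bounded_linear_blinfun_inner_left, of "?D y" "cbox a b"]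
    by (simp add: o_def integrable_continuous continuous_intros continuous_on_subset[OF g])
  ultimately show "GDERIV (\<lambda>y. integral (cbox a b) (\<lambda>w. g w * bump r (y - w))) y :>
      integral (cbox a b) (?D y)"
    by (simp add: gderiv_def)
qed

lemma integral_lborel_translate:
  fixes F :: "'a::euclidean_space \<Rightarrow> real"
  assumes F: "continuous_on UNIV F" and vanish: "\<And>w. w \<notin> cbox a b \<Longrightarrow> F w = 0"
  shows "integrable lborel (\<lambda>z. F (x + z))"
    and "integral (cbox a b) F = (LINT z|lborel. F (x + z))"
proof -
  have ind: "(\<lambda>w. indicator (cbox a b) w *\<^sub>R F w) = F"
  proof (rule ext)
    fix w show "indicator (cbox a b) w *\<^sub>R F w = F w"
      using vanish[of w] by (cases "w \<in> cbox a b") simp_all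
  qed
  have "integrable lborel (\<lambda>w. indicator (cbox a b) w *\<^sub>R F w)"
    by (rule borel_integrable_compact) (auto intro: continuous_on_subset[OF F])
  then have int: "integrable lborel F" and si: "set_integrable lborel (cbox a b) F"
    by (simp_all only: ind set_integrable_def)
  have "(LINT w:cbox a b|lborel. F w) = integral (cbox a b) F"
    by (rule set_borel_integral_eq_integral[OF si])
  moreover have "(LINT w:cbox a b|lborel. F w) = (LINT w|lborel. F w)"
    by (simp only: set_lebesgue_integral_def ind)
  moreover have "(LINT w|distr lborel borel ((+) x). F w) = (LINT z|lborel. F (x + z))"
    using int by (intro integral_distr) auto
  ultimately show "integral (cbox a b) F = (LINT z|lborel. F (x + z))"
    by (simp add: lborel_distr_plus)
  have "integrable (distr lborel borel ((+) x)) F" using int by (simp add: lborel_distr_plus)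
  then show "integrable lborel (\<lambda>z. F (x + z))"
    using int by (subst (asm) integrable_distr_eq) auto
qed

lemma bump_integral:
  fixes r :: real
  assumes r: "0 < r"
  shows "integrable lborel (bump r :: 'a::euclidean_space \<Rightarrow> real)"
    and "0 < (LINT z::'a|lborel. bump r z)"
proof -
  obtain a :: 'a where a: "cball 0 r \<subseteq> cbox (- a) a"
    using bounded_subset_cbox_symmetric[OF bounded_cball] by blast
  have cont: "continuous_on UNIV (bump r :: 'a \<Rightarrow> real)" by (intro continuous_intros)
  have van: "w \<notin> cbox (- a) a \<Longrightarrow> bump r w = 0" for w
    using a r by (intro bump_eq_0) (force simp: subset_eq)+
  note I = integral_lborel_translate[OF cont van, where x=0, simplified]
  show "integrable lborel (bump r :: 'a \<Rightarrow> real)" by (rule I)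
  have "0 \<le> (LINT z::'a|lborel. bump r z)" by (intro integral_nonneg_AE) (simp add: bump_nonneg)
  moreover have False if z: "(LINT z::'a|lborel. bump r z) = 0"
  proof -
    have "ball 0 r \<subseteq> cbox (- a) a" using a ball_subset_cball by blast
    then have sub: "ball 0 r \<subseteq> box (- a) a"
      using interior_maximal[OF _ open_ball] by (metis interior_cbox)
    have "bump r (0::'a) = 0"
    proof (rule has_integral_0_cbox_imp_0[where f="bump r" and a="- a" and b=a])
      show "(bump r has_integral 0) (cbox (- a) a)"
        using I(2) z integrable_continuous[OF continuous_on_subset[OF cont subset_UNIV]]
        by (metis integrable_integral)
      show "box (- a) a \<noteq> {}" using sub r by auto
      show "0 \<in> cbox (- a) a" using a r by auto
    qed (auto intro: continuous_on_subset[OF cont] bump_nonneg)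
    then show False using r by (simp add: bump_def)
  qed
  ultimately show "0 < (LINT z::'a|lborel. bump r z)" by fastforce
qed

text \<open>
  The closed \<open>d\<close>-neighbourhood of \<open>Y\<close>; this description by balls agrees with the one by the distance to
  \<open>Y\<close> for nonempty compact \<open>Y\<close> and makes a nearby point of \<open>Y\<close> available at once.
\<close>

definition thicken :: "'a::metric_space set \<Rightarrow> real \<Rightarrow> 'a set" where
  "thicken Y d = (\<Union>y\<in>Y. cball y d)"

lemma thickenI: "y \<in> Y \<Longrightarrow> dist y x \<le> d \<Longrightarrow> x \<in> thicken Y d"
  by (auto simp: thicken_def)

lemma thickenE:
  assumes "x \<in> thicken Y d" obtains y where "y \<in> Y" "dist y x \<le> d"
  using assms by (auto simp: thicken_def)

lemma thicken_step:
  fixes x v :: "'a::real_normed_vector"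
  assumes "x \<in> thicken Y d" "norm v \<le> e" "d + e \<le> d'"
  shows "x + v \<in> thicken Y d'"
proof -
  obtain y where y: "y \<in> Y" "dist y x \<le> d" using assms(1) by (rule thickenE)
  have "dist y (x + v) \<le> dist y x + dist x (x + v)" by (rule dist_triangle)
  also have "dist x (x + v) = norm v" by (simp add: dist_norm)
  finally show ?thesis using y assms by (intro thickenI[OF y(1)]) auto
qed

lemma subset_thicken: "0 \<le> d \<Longrightarrow> Y \<subseteq> thicken Y d"
  by (auto intro: thickenI)

lemma thicken_mono: "d \<le> e \<Longrightarrow> thicken Y d \<subseteq> thicken Y e"
  by (force simp: thicken_def)

lemma compact_thicken:
  fixes Y :: "'a::euclidean_space set"
  assumes "compact Y"
  shows "compact (thicken Y d)"
proof -
  have "thicken Y d = {x + y | x y. x \<in> Y \<and> y \<in> cball 0 d}"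
  proof (intro equalityI subsetI)
    fix x assume "x \<in> thicken Y d"
    then obtain y where "y \<in> Y" "dist y x \<le> d" by (rule thickenE)
    then show "x \<in> {x + y | x y. x \<in> Y \<and> y \<in> cball 0 d}"
      by (intro CollectI exI[of _ y] exI[of _ "x - y"]) (simp add: dist_norm norm_minus_commute)
  qed (auto intro!: thickenI simp: dist_norm)
  moreover have "compact {x + y | x y. x \<in> Y \<and> y \<in> cball 0 d}"
    by (rule compact_sums[OF assms compact_cball])
  ultimately show ?thesis by (simp only:)
qed

context control_system
begin

text \<open>
  The hypothesis \<open>euler\<close> is a one-sided differential inequality for \<open>\<eta>\<close>, stated along straight Euler steps
  because these are compatible with translation. Let \<open>\<phi>\<close> be the average of \<open>\<eta> (y + z)\<close> over \<open>z\<close> in the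
  \<open>r\<close>-ball. The increment of \<open>\<phi>\<close> in direction \<open>f (y, u)\<close> is the average of increments of \<open>\<eta>\<close> from \<open>y + z\<close>
  in that direction; replacing the direction by \<open>f (y + z, u)\<close> costs at most \<open>K * L * r\<close> per unit time
  and replacing \<open>c (y + z, u)\<close> by \<open>c (y, u)\<close> at most \<open>Kc * r\<close>. Their sum is at most \<open>e\<close> for small \<open>r\<close>,
  whatever the step length, so letting the step tend to \<open>0\<close> gives the inequality for the gradient.
\<close>

lemma smooth_subsolution:
  assumes Y: "compact Y" and d: "0 < d" and u0: "u0 \<in> U"
    and eta: "K-lipschitz_on (thicken Y d) \<eta>"
    and c: "\<And>u. u \<in> U \<Longrightarrow> Kc-lipschitz_on (thicken Y d) (\<lambda>y. c (y, u))"
    and euler: "\<And>y u h. y \<in> thicken Y (d / 2) \<Longrightarrow> u \<in> U \<Longrightarrow> 0 < h \<Longrightarrow> h < h0 \<Longrightarrow>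
      \<eta> y - h * c (y, u) - C * h\<^sup>2 \<le> \<eta> (y + h *\<^sub>R f (y, u))"
    and h0: "0 < h0" and e: "0 < e"
  obtains \<phi> where "\<phi> \<in> C1" "\<And>y. y \<in> Y \<Longrightarrow> \<bar>\<phi> y - \<eta> y\<bar> \<le> e"
    "\<And>y u. y \<in> Y \<Longrightarrow> u \<in> U \<Longrightarrow> - c (y, u) - e \<le> gradient \<phi> y \<bullet> f (y, u)"
proof -
  have L: "0 \<le> L" by (rule L_nonneg[OF u0])
  have K: "0 \<le> K" by (rule lipschitz_on_nonneg[OF eta])
  have Kc: "0 \<le> Kc" by (rule lipschitz_on_nonneg[OF c[OF u0]])
  define S where "S = thicken Y d"
  have S: "compact S" unfolding S_def by (rule compact_thicken[OF Y])
  \<comment> \<open>The bound \<open>d / 4\<close> leaves room for the translation and an Euler step inside \<open>thicken Y d\<close>; the second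
    bound makes \<open>K * r\<close> and \<open>(Kc + K * L) * r\<close> at most \<open>e\<close>.\<close>
  define r where "r = min (d / 4) (e / (K + Kc + K * L + 1))"
  have pos: "0 < K + Kc + K * L + 1" using K Kc L by (simp add: add_nonneg_pos)
  have r: "0 < r" "r \<le> d / 4" using d e pos unfolding r_def by (simp, intro min.cobounded1)
  have "r * (K + Kc + K * L + 1) \<le> e"
    unfolding pos_le_divide_eq[OF pos, symmetric] r_def by (rule min.cobounded2)
  moreover have "0 \<le> r * K" "0 \<le> r * Kc" "0 \<le> r * (K * L)"
    using r K Kc L by simp_all
  ultimately have re: "K * r \<le> e" "Kc * r + K * L * r \<le> e"
    using r by (simp_all add: algebra_simps)
  \<comment> \<open>A continuous extension of \<open>\<eta>\<close> makes the mollification \<open>C1\<close> on the whole space; its values off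
    \<open>S\<close> do not enter near \<open>Y\<close>.\<close>
  obtain g where g: "continuous_on UNIV g" "\<And>x. x \<in> S \<Longrightarrow> g x = \<eta> x"
  proof (rule Dugundji[of UNIV UNIV S \<eta>])
    show "continuous_on S \<eta>" using eta unfolding S_def by (rule lipschitz_on_continuous_on)
    show "closedin (top_of_set UNIV) S" using compact_imp_closed[OF S] by simp
  qed auto
  obtain a where a: "S \<subseteq> cbox (- a) a"
    using bounded_subset_cbox_symmetric[OF compact_imp_bounded[OF S]] by blast
  define Z where "Z = (LINT z::real^'m|lborel. bump r z)"
  have Z: "0 < Z" unfolding Z_def by (rule bump_integral[OF r(1)])
  define \<phi> where "\<phi> y = integral (cbox (- a) a) (\<lambda>w. (g w / Z) * bump r (y - w))" for y
  have phi_C1: "\<phi> \<in> C1"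
    unfolding \<phi>_def[abs_def] using Z by (intro mollification_C1 continuous_intros g) auto
  define p where "p z = bump r z / Z" for z :: "real^'m"
  have p_nonneg: "0 \<le> p z" for z using Z by (simp add: p_def bump_nonneg)
  have p_0: "p z = 0" if "r < norm z" for z using that r by (simp add: p_def bump_eq_0)
  have p_int: "integrable lborel p" "(LINT z|lborel. p z) = 1"
    using bump_integral(1)[OF r(1), where 'a="real^'m"] Z
    unfolding p_def[abs_def] Z_def by simp_all
  have rep: "integrable lborel (\<lambda>z. p z * g (y + z))" "\<phi> y = (LINT z|lborel. p z * g (y + z))"
    if y: "y \<in> thicken Y (d / 2)" for y
  proof -
    have "w \<in> S" if "norm (y - w) \<le> r" for w
      using thicken_step[OF y, of "w - y" r d] that r d by (simp add: S_def norm_minus_commute)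
    then have van: "(g w / Z) * bump r (y - w) = 0" if "w \<notin> cbox (- a) a" for w
      using that a r bump_eq_0[of r "y - w"] by force
    have cont: "continuous_on UNIV (\<lambda>w. (g w / Z) * bump r (y - w))"
      using Z by (intro continuous_intros g) auto
    have eq: "(g (y + z) / Z) * bump r (y - (y + z)) = p z * g (y + z)" for z
      by (simp add: p_def bump_minus)
    note T = integral_lborel_translate[OF cont, of "- a" a y, unfolded eq]
    show "integrable lborel (\<lambda>z. p z * g (y + z))" by (rule T(1)) (rule van)
    show "\<phi> y = (LINT z|lborel. p z * g (y + z))" unfolding \<phi>_def by (rule T(2)) (rule van)
  qed
  have average: "m \<le> (LINT z|lborel. p z * q z)"
    if q: "\<And>z. norm z \<le> r \<Longrightarrow> m \<le> q z" and int: "integrable lborel (\<lambda>z. p z * q z)" for q :: "real^'m \<Rightarrow> real" and m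
  proof -
    have "m = (LINT z|lborel. p z * m)" using p_int by simp
    also have "\<dots> \<le> (LINT z|lborel. p z * q z)"
    proof (intro integral_mono int)
      show "integrable lborel (\<lambda>z. p z * m)" using p_int by simp
      show "p z * m \<le> p z * q z" for z
        using q[of z] p_0[of z] p_nonneg[of z] by (cases "norm z \<le> r") (auto intro: mult_left_mono)
    qed
    finally show ?thesis .
  qed
  have YS: "y \<in> thicken Y (d / 2)" "y \<in> S" if "y \<in> Y" for y
    using that d subset_thicken[of "d/2" Y] subset_thicken[of d Y] by (auto simp: S_def)
  have approx: "\<bar>\<phi> y - \<eta> y\<bar> \<le> e" if y: "y \<in> Y" for y
  proof -
    have near: "\<bar>g (y + z) - \<eta> y\<bar> \<le> e" if z: "norm z \<le> r" for z
    proof -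
      have yz: "y + z \<in> S" using thicken_step[OF YS(1)[OF y] z] r d by (simp add: S_def)
      have "\<bar>\<eta> (y + z) - \<eta> y\<bar> \<le> K * norm z"
        using lipschitz_onD[OF eta, of "y + z" y] yz YS(2)[OF y] by (simp add: S_def dist_norm)
      also have "\<dots> \<le> e" using mult_left_mono[OF z K] re by simp
      finally show ?thesis using g(2)[OF yz] by simp
    qed
    have "\<eta> y - e \<le> \<phi> y"
      unfolding rep(2)[OF YS(1)[OF y]]
      by (rule average) (use near rep(1)[OF YS(1)[OF y]] in \<open>fastforce simp: abs_le_iff\<close>)+
    moreover have "- \<eta> y - e \<le> (LINT z|lborel. p z * - g (y + z))"
      by (rule average) (use near rep(1)[OF YS(1)[OF y]] in \<open>fastforce simp: abs_le_iff\<close>)+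
    then have "- \<eta> y - e \<le> - \<phi> y"
      unfolding rep(2)[OF YS(1)[OF y]] by simp
    ultimately show ?thesis by linarith
  qed
  have slope: "- c (y, u) - e \<le> gradient \<phi> y \<bullet> f (y, u)" if y: "y \<in> Y" and u: "u \<in> U" for y u
  proof -
    define v where "v = f (y, u)"
    have inc: "- c (y, u) - e - C * h \<le> (\<phi> (y + h *\<^sub>R v) - \<phi> y) / h"
      if h: "0 < h" "h < h0" "h * (norm v + L * r) \<le> d / 4" for h
    proof -
      have "0 \<le> h * (L * r)" using h r L by simp
      then have hv: "h * norm v \<le> d / 4" using h(3) by (simp add: distrib_left)
      have yh: "y + h *\<^sub>R v \<in> thicken Y (d / 2)"
        by (rule thicken_step[OF subsetD[OF subset_thicken y], of 0 "h *\<^sub>R v" "d/4"])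
          (use h hv d in auto)
      have pt: "- h * (c (y, u) + e + C * h) \<le> g (y + h *\<^sub>R v + z) - g (y + z)"
        if z: "norm z \<le> r" for z
      proof -
        let ?x = "y + z"
        have x: "?x \<in> thicken Y (d / 4)"
          by (rule thicken_step[OF subsetD[OF subset_thicken y], of 0 z r]) (use z r in auto)
        have x': "?x \<in> thicken Y (d / 2)" "?x \<in> S"
          using x thicken_mono[of "d/4" "d/2" Y] thicken_mono[of "d/4" d Y] d by (auto simp: S_def)
        have hf: "norm (h *\<^sub>R f (?x, u) - h *\<^sub>R v) \<le> h * (L * r)"
        proof -
          have "norm (f (?x, u) - v) \<le> L * r"
            using f_lipschitz[OF u, of ?x y] mult_left_mono[OF z L] by (simp add: v_def)
          then show ?thesis using h by (simp flip: scaleR_diff_right add: mult_left_mono)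
        qed
        have p1: "?x + h *\<^sub>R v \<in> S"
          unfolding S_def by (rule thicken_step[OF x, of _ "d/4"]) (use h hv d in auto)
        have "norm (h *\<^sub>R f (?x, u)) \<le> d / 4"
          using hf h norm_triangle_sub[of "h *\<^sub>R f (?x, u)" "h *\<^sub>R v"] by (simp add: distrib_left)
        then have p2: "?x + h *\<^sub>R f (?x, u) \<in> S"
          unfolding S_def by (rule thicken_step[OF x]) (use d in auto)
        have "\<eta> ?x - h * c (?x, u) - C * h\<^sup>2 \<le> \<eta> (?x + h *\<^sub>R f (?x, u))"
          by (rule euler[OF x'(1) u h(1,2)])
        moreover have "\<bar>\<eta> (?x + h *\<^sub>R f (?x, u)) - \<eta> (?x + h *\<^sub>R v)\<bar> \<le> K * (h * (L * r))"
          using lipschitz_onD[OF eta p2[unfolded S_def] p1[unfolded S_def]] mult_left_mono[OF hf K]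
          by (simp add: dist_norm)
        moreover have "\<bar>c (?x, u) - c (y, u)\<bar> \<le> Kc * r"
          using lipschitz_onD[OF c[OF u], of ?x y] x'(2) YS(2)[OF y] mult_left_mono[OF z Kc]
          by (simp add: dist_norm S_def)
        then have "h * c (?x, u) \<le> h * (c (y, u) + Kc * r)" using h by (intro mult_left_mono) auto
        moreover have "h * (Kc * r + K * L * r) \<le> h * e" using h re by (intro mult_left_mono) auto
        ultimately have "- h * (c (y, u) + e + C * h) \<le> \<eta> (?x + h *\<^sub>R v) - \<eta> ?x"
          by (simp add: algebra_simps power2_eq_square)
        then show ?thesis using g(2)[OF p1] g(2)[OF x'(2)] by (simp add: add_ac)
      qed
      have int: "integrable lborel (\<lambda>z. p z * (g (y + h *\<^sub>R v + z) - g (y + z)))"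
        using Bochner_Integration.integrable_diff[OF rep(1)[OF yh] rep(1)[OF YS(1)[OF y]]]
        by (simp add: algebra_simps)
      have "- h * (c (y, u) + e + C * h) \<le> (LINT z|lborel. p z * (g (y + h *\<^sub>R v + z) - g (y + z)))"
        by (rule average[OF pt int])
      also have "\<dots> = \<phi> (y + h *\<^sub>R v) - \<phi> y"
        unfolding rep(2)[OF yh] rep(2)[OF YS(1)[OF y]]
        by (simp add: right_diff_distrib Bochner_Integration.integral_diff rep(1)[OF yh] rep(1)[OF YS(1)[OF y]])
      finally show ?thesis using h by (simp add: field_simps)
    qed
    have "((\<lambda>h. y + h *\<^sub>R v) has_derivative (\<lambda>h. h *\<^sub>R v)) (at 0)"
      by (auto intro!: derivative_eq_intros)
    moreover have "(\<phi> has_derivative (\<lambda>h. h \<bullet> gradient \<phi> y)) (at (y + 0 *\<^sub>R v))"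
      using C1_GDERIV[OF phi_C1, of y] by (simp add: gderiv_def)
    ultimately have "((\<lambda>h. \<phi> (y + h *\<^sub>R v)) has_derivative (\<lambda>h. (h *\<^sub>R v) \<bullet> gradient \<phi> y)) (at 0)"
      by (rule has_derivative_compose)
    then have "((\<lambda>h. \<phi> (y + h *\<^sub>R v)) has_real_derivative (gradient \<phi> y \<bullet> v)) (at 0)"
      by (rule has_derivative_imp_has_field_derivative) (simp add: inner_commute mult.commute)
    then have lim: "((\<lambda>h. (\<phi> (y + h *\<^sub>R v) - \<phi> y) / h) \<longlongrightarrow> gradient \<phi> y \<bullet> v) (at_right 0)"
      unfolding DERIV_def by (auto intro: tendsto_within_subset)
    have "((\<lambda>h. - c (y, u) - e - C * h) \<longlongrightarrow> - c (y, u) - e - C * 0) (at_right 0)"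
      by (intro tendsto_intros)
    then have low: "((\<lambda>h. - c (y, u) - e - C * h) \<longlongrightarrow> - c (y, u) - e) (at_right 0)" by simp
    have "((\<lambda>h. h * (norm v + L * r)) \<longlongrightarrow> 0 * (norm v + L * r)) (at_right 0)"
      by (intro tendsto_intros)
    then have "\<forall>\<^sub>F h in at_right 0. h * (norm v + L * r) < d / 4"
      by (rule order_tendstoD) (use d in auto)
    moreover have "\<forall>\<^sub>F h in at_right 0. h < h0 \<and> 0 < h"
      using h0 by (auto simp: eventually_at_right_field)
    ultimately have "\<forall>\<^sub>F h in at_right 0. - c (y, u) - e - C * h \<le> (\<phi> (y + h *\<^sub>R v) - \<phi> y) / h"
      by eventually_elim (use inc in auto)
    then show ?thesis
      using tendsto_le[OF _ lim low] by (simp add: v_def)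
  qed
  show ?thesis using phi_C1 approx slope by (rule that)
qed

end

section \<open>Optimal costs on an invariant set\<close>

text \<open>
  Everything that depends on the compact set \<open>Y\<close> being forward invariant. By Gronwall's inequality
  trajectories starting in a neighbourhood of \<open>Y\<close> stay in a larger neighbourhood for a bounded time,
  which provides all bounds that are needed outside \<open>Y\<close>.
\<close>

locale invariant_system = control_system U f L
  for U :: "'u::metric_space set" and f :: "(real^'m) \<times> 'u \<Rightarrow> real^'m" and L +
  fixes Y :: "(real^'m) set" and k :: "(real^'m) \<times> 'u \<Rightarrow> real"
  assumes compact_Y: "compact Y" and Y_nonempty: "Y \<noteq> {}" and U_nonempty: "U \<noteq> {}"
    and cont_k: "continuous_on (UNIV \<times> U) k"
    and invariant: "\<And>y u t. y \<in> Y \<Longrightarrow> u \<in> controls U \<Longrightarrow> 0 \<le> t \<Longrightarrow> traj f y u t \<in> Y"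
begin

lemma L_ge_0: "0 \<le> L" using U_nonempty L_nonneg by blast

lemma controls_nonempty: "controls U \<noteq> {}" using U_nonempty const_control by blast

text \<open>
  The trajectory from a point of \<open>Y\<close> within distance \<open>d\<close> of \<open>x\<close>, driven by the same control, never leaves
  \<open>Y\<close> and serves as comparison.
\<close>

lemma traj_near:
  assumes x: "x \<in> thicken Y d" and u: "u \<in> controls U" and t: "0 \<le> t" "t \<le> T" and d: "0 \<le> d"
  shows "traj f x u t \<in> thicken Y (d * exp (L * T))"
proof -
  obtain y where y: "y \<in> Y" "dist y x \<le> d" using x by (rule thickenE)
  have "dist (traj f y u t) (traj f x u t) \<le> dist y x * exp (L * t)"
    using traj_dependence[OF u t(1), of y x] by (simp add: dist_norm)
  also have "\<dots> \<le> d * exp (L * T)"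
    using y t d L_ge_0 by (intro mult_mono) (auto intro: mult_left_mono)
  finally show ?thesis by (rule thickenI[OF invariant[OF y(1) u t(1)]])
qed

lemma thicken_exhausts:
  obtains d where "0 \<le> d" "x \<in> thicken Y d"
proof -
  obtain y where "y \<in> Y" using Y_nonempty by blast
  then show ?thesis by (intro that[of "dist y x"]) (auto intro: thickenI)
qed

lemma running_integrable:
  fixes g :: "(real^'m) \<times> 'u \<Rightarrow> 'b::euclidean_space"
  assumes "u \<in> controls U" "continuous_on (UNIV \<times> U) g" "0 \<le> a"
  shows "(\<lambda>t. g (traj f x u t, u t)) absolutely_integrable_on {a..b}"
  by (rule control_integrable[OF assms(1) traj_continuous[OF assms(1,3)] assms(3) subset_UNIV
        compact_U assms(2)])

lemma running_bounded:
  fixes g :: "(real^'m) \<times> 'u \<Rightarrow> 'b::real_normed_vector"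
  assumes g: "continuous_on (UNIV \<times> U) g" and d: "0 \<le> d"
  obtains B where "0 \<le> B" "\<And>x u t. x \<in> thicken Y d \<Longrightarrow> u \<in> controls U \<Longrightarrow> 0 \<le> t \<Longrightarrow> t \<le> T \<Longrightarrow>
    norm (g (traj f x u t, u t)) \<le> B"
proof -
  have "compact (thicken Y (d * exp (L * T)) \<times> U)"
    by (intro compact_Times compact_thicken compact_Y compact_U)
  moreover have "continuous_on (thicken Y (d * exp (L * T)) \<times> U) g"
    by (rule continuous_on_subset[OF g]) auto
  ultimately obtain B where B: "0 \<le> B" "\<And>z. z \<in> thicken Y (d * exp (L * T)) \<times> U \<Longrightarrow> norm (g z) \<le> B"
    by (rule continuous_bounded_on_compact) blast
  show ?thesis
    by (rule that[OF B(1)]) (use traj_near control_in d in \<open>auto intro!: B(2)\<close>)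
qed

lemma running_prepend:
  fixes g :: "(real^'m) \<times> 'u \<Rightarrow> 'b::euclidean_space"
  assumes u: "u \<in> controls U" and a: "a \<in> U" and h: "0 \<le> h"
  shows "integral {0..h} (\<lambda>t. g (traj f x (prepend h a u) t, prepend h a u t))
      = integral {0..h} (\<lambda>t. g (traj f x (\<lambda>_. a) t, a))"
    and "0 \<le> s \<Longrightarrow> g (traj f x (prepend h a u) (h + s), prepend h a u (h + s))
      = g (traj f (traj f x (\<lambda>_. a) h) u s, u s)"
proof -
  show "integral {0..h} (\<lambda>t. g (traj f x (prepend h a u) t, prepend h a u t))
      = integral {0..h} (\<lambda>t. g (traj f x (\<lambda>_. a) t, a))"
    \<comment> \<open>At time \<open>h\<close> itself the prepended control already equals \<open>u 0\<close>, not \<open>a\<close>.\<close>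
    by (rule integral_spike[of "{h}"])
      (use traj_prepend_before[OF u a] in \<open>auto simp: prepend_def\<close>)
  show "g (traj f x (prepend h a u) (h + s), prepend h a u (h + s))
      = g (traj f (traj f x (\<lambda>_. a) h) u s, u s)" if "0 \<le> s"
    using that traj_prepend_after[OF u a h that] by (simp add: prepend_def)
qed

definition cost :: "real \<Rightarrow> real^'m \<Rightarrow> (real \<Rightarrow> 'u) \<Rightarrow> real" where
  "cost T x u = integral {0..T} (\<lambda>t. k (traj f x u t, u t))"

definition optimal_cost :: "real \<Rightarrow> real^'m \<Rightarrow> real" where
  "optimal_cost T x = (INF u\<in>controls U. cost T x u)"

lemma v_T_eq: "v_T f k U T x = optimal_cost T x / T"
  unfolding v_T_def optimal_cost_def cost_def
  by (simp add: set_lebesgue_integral_eq_integral(2) running_integrable cont_k cong: INF_cong_simp)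

lemma bdd_below_running:
  fixes G :: "(real \<Rightarrow> 'u) \<Rightarrow> real \<Rightarrow> real"
  assumes "\<And>u. u \<in> A \<Longrightarrow> G u integrable_on {0..T}" "\<And>u t. u \<in> A \<Longrightarrow> 0 \<le> t \<Longrightarrow> t \<le> T \<Longrightarrow> \<bar>G u t\<bar> \<le> B"
    "0 \<le> B" "0 \<le> T"
  shows "bdd_below ((\<lambda>u. integral {0..T} (G u)) ` A)"
proof (rule bdd_belowI2)
  fix u assume u: "u \<in> A"
  have "norm (integral {0..T} (G u)) \<le> B * (T - 0)"
    using assms u by (intro norm_integral_le) auto
  then show "- (B * T) \<le> integral {0..T} (G u)" by (simp add: abs_le_iff)
qed

lemma cost_bdd_below:
  assumes "0 \<le> T" shows "bdd_below (cost T x ` controls U)"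
proof -
  obtain d where d: "0 \<le> d" "x \<in> thicken Y d" by (rule thicken_exhausts)
  obtain B where "0 \<le> B" "\<And>x u t. x \<in> thicken Y d \<Longrightarrow> u \<in> controls U \<Longrightarrow> 0 \<le> t \<Longrightarrow> t \<le> T \<Longrightarrow>
    norm (k (traj f x u t, u t)) \<le> B"
    using running_bounded[OF cont_k d(1)] by blast
  then show ?thesis
    unfolding cost_def[abs_def] using d assms
    by (intro bdd_below_running[where B=B] absolutely_integrable_imp_integrable
        running_integrable cont_k) auto
qed

lemma optimal_cost_le: "u \<in> controls U \<Longrightarrow> 0 \<le> T \<Longrightarrow> optimal_cost T x \<le> cost T x u"
  unfolding optimal_cost_def by (rule cINF_lower[OF cost_bdd_below])

text \<open>
  Only the inequality for a constant initial control is stated: it already determines the derivative of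
  the value function in each direction \<open>f (x, a)\<close>.
\<close>

lemma dynamic_programming:
  assumes a: "a \<in> U" and h: "0 \<le> h" and T: "0 \<le> T"
  shows "optimal_cost (h + T) x \<le> cost h x (\<lambda>_. a) + optimal_cost T (traj f x (\<lambda>_. a) h)"
proof -
  let ?p = "traj f x (\<lambda>_. a) h"
  have "optimal_cost (h + T) x - cost h x (\<lambda>_. a) \<le> cost T ?p u" if u: "u \<in> controls U" for u
  proof -
    let ?v = "prepend h a u" let ?G = "\<lambda>t. k (traj f x ?v t, ?v t)"
    have v: "?v \<in> controls U" by (rule prepend_control[OF u a])
    have "optimal_cost (h + T) x \<le> cost (h + T) x ?v" using v h T by (intro optimal_cost_le) auto
    also have "cost (h + T) x ?v = integral {0..h} ?G + integral {h..h + T} ?G"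
      unfolding cost_def using h T
      by (intro Henstock_Kurzweil_Integration.integral_combine[symmetric]
          absolutely_integrable_imp_integrable running_integrable v cont_k) auto
    also have "integral {0..h} ?G = cost h x (\<lambda>_. a)"
      unfolding cost_def by (rule running_prepend(1)[OF u a h])
    also have "integral {h..h + T} ?G = integral {0..T} (?G \<circ> (+) h)"
      using integral_shift_Icc_real[of 0 T ?G h] by (simp add: add.commute)
    also have "\<dots> = cost T ?p u"
      unfolding cost_def o_def by (intro integral_cong running_prepend(2)[OF u a h]) simp
    finally show ?thesis by simp
  qed
  then have "optimal_cost (h + T) x - cost h x (\<lambda>_. a) \<le> optimal_cost T ?p"
    unfolding optimal_cost_def[of T ?p] by (intro cINF_greatest controls_nonempty)
  then show ?thesis by simp
qed

lemma traj_const_displacement: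
  assumes a: "a \<in> U" and M: "\<And>s. 0 \<le> s \<Longrightarrow> s \<le> t \<Longrightarrow> norm (f (traj f x (\<lambda>_. a) s, a)) \<le> M"
    and t: "0 \<le> t"
  shows "norm (traj f x (\<lambda>_. a) t - x) \<le> M * t"
    and "norm (traj f x (\<lambda>_. a) t - (x + t *\<^sub>R f (x, a))) \<le> L * M * t\<^sup>2"
proof -
  have u: "(\<lambda>_. a) \<in> controls U" by (rule const_control[OF a])
  let ?y = "traj f x (\<lambda>_. a)"
  have int: "(\<lambda>s. f (?y s, a)) integrable_on {0..s}" for s
    using traj_velocity_integrable[OF u order_refl] .
  have M0: "0 \<le> M" using M[of 0] t by (auto intro: order_trans[OF norm_ge_zero])
  have disp: "norm (?y s - x) \<le> M * s" if s: "0 \<le> s" "s \<le> t" for s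
  proof -
    have "norm (integral {0..s} (\<lambda>s. f (?y s, a))) \<le> M * (s - 0)"
      using M s M0 by (intro norm_integral_le int) auto
    then show ?thesis using traj_eq[OF u s(1), of x] by simp
  qed
  then show "norm (?y t - x) \<le> M * t" using t by simp
  have "?y t - (x + t *\<^sub>R f (x, a)) = integral {0..t} (\<lambda>s. f (?y s, a) - f (x, a))"
    using traj_eq[OF u t, of x] t by (simp add: integral_diff int integrable_const_ivl)
  also have "norm \<dots> \<le> (L * (M * t)) * (t - 0)"
  proof (rule norm_integral_le)
    show "(\<lambda>s. f (?y s, a) - f (x, a)) integrable_on {0..t}"
      by (intro integrable_diff int integrable_const_ivl)
    fix s assume s: "s \<in> {0..t}"
    have "norm (f (?y s, a) - f (x, a)) \<le> L * norm (?y s - x)" by (rule f_lipschitz[OF a])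
    also have "\<dots> \<le> L * (M * t)"
      using disp[of s] s mult_left_mono[of s t M] M0 by (intro mult_left_mono L_ge_0) auto
    finally show "norm (f (?y s, a) - f (x, a)) \<le> L * (M * t)" .
  qed (use L_ge_0 M0 t in auto)
  finally show "norm (?y t - (x + t *\<^sub>R f (x, a))) \<le> L * M * t\<^sup>2"
    by (simp add: power2_eq_square mult_ac)
qed

text \<open>
  Dynamic programming compares \<open>\<eta>\<close> at the two ends of a trajectory with constant control. Its end point
  differs from the Euler step by \<open>O(h\<^sup>2)\<close>, which the Lipschitz continuity of \<open>\<eta>\<close> absorbs.
\<close>

lemma smooth_subsolution_flow:
  assumes d: "0 < d" and eta: "K-lipschitz_on (thicken Y d) \<eta>"
    and c: "\<And>u. u \<in> U \<Longrightarrow> Kc-lipschitz_on (thicken Y d) (\<lambda>y. c (y, u))"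
    and flow: "\<And>x a h. x \<in> thicken Y (d / 2) \<Longrightarrow> a \<in> U \<Longrightarrow> 0 < h \<Longrightarrow> h < 1 \<Longrightarrow>
      traj f x (\<lambda>_. a) h \<in> thicken Y d \<Longrightarrow>
      \<eta> x - h * c (x, a) - C * h\<^sup>2 \<le> \<eta> (traj f x (\<lambda>_. a) h)"
    and e: "0 < e"
  obtains \<phi> where "\<phi> \<in> C1" "\<And>y. y \<in> Y \<Longrightarrow> \<bar>\<phi> y - \<eta> y\<bar> \<le> e"
    "\<And>y u. y \<in> Y \<Longrightarrow> u \<in> U \<Longrightarrow> - c (y, u) - e \<le> gradient \<phi> y \<bullet> f (y, u)"
proof -
  obtain u0 where u0: "u0 \<in> U" using U_nonempty by blast
  obtain M where M: "0 \<le> M" "\<And>x u t. x \<in> thicken Y d \<Longrightarrow> u \<in> controls U \<Longrightarrow> 0 \<le> t \<Longrightarrow> t \<le> 1 \<Longrightarrow>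
      norm (f (traj f x u t, u t)) \<le> M"
    using running_bounded[OF cont_f less_imp_le[OF d], of 1] by blast
  have K: "0 \<le> K" by (rule lipschitz_on_nonneg[OF eta])
  \<comment> \<open>Up to time \<open>h0\<close> neither the trajectory nor the Euler step moves farther than \<open>d / 2\<close>.\<close>
  define h0 where "h0 = min 1 (d / 2 / (M + 1))"
  have h0: "0 < h0" using d M by (simp add: h0_def add_nonneg_pos)
  have euler: "\<eta> x - h * c (x, a) - (C + K * (L * M)) * h\<^sup>2 \<le> \<eta> (x + h *\<^sub>R f (x, a))"
    if x: "x \<in> thicken Y (d / 2)" and a: "a \<in> U" and h: "0 < h" "h < h0" for x a h
  proof -
    let ?p = "traj f x (\<lambda>_. a) h" and ?q = "x + h *\<^sub>R f (x, a)"
    have h1: "h < 1" and "h < d / 2 / (M + 1)" using h by (auto simp: h0_def)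
    then have hM: "M * h \<le> d / 2" using M h by (simp add: field_simps)
    have xd: "x \<in> thicken Y d" using x thicken_mono[of "d / 2" d Y] d by auto
    have u: "(\<lambda>_. a) \<in> controls U" by (rule const_control[OF a])
    have Ms: "norm (f (traj f x (\<lambda>_. a) s, a)) \<le> M" if "0 \<le> s" "s \<le> h" for s
      using M(2)[OF xd u, of s] that h1 by simp
    have "norm (?p - x) \<le> M * h" using traj_const_displacement(1)[OF a Ms] h by simp
    then have p: "?p \<in> thicken Y d"
      using thicken_step[OF x, of "?p - x" "d / 2" d] hM by simp
    have "norm (f (x, a)) \<le> M" using Ms[of 0] h traj_0[OF u] by simp
    then have "h * norm (f (x, a)) \<le> h * M" using h by (intro mult_left_mono) auto
    with h hM have "norm (h *\<^sub>R f (x, a)) \<le> d / 2" unfolding norm_scaleR mult.commute[of h M] by linarith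
    then have q: "?q \<in> thicken Y d" by (rule thicken_step[OF x]) simp
    have "norm (?p - ?q) \<le> L * M * h\<^sup>2" using traj_const_displacement(2)[OF a Ms] h by simp
    then have "\<bar>\<eta> ?p - \<eta> ?q\<bar> \<le> K * (L * M * h\<^sup>2)"
      using lipschitz_onD[OF eta p q] mult_left_mono[OF _ K] by (fastforce simp: dist_norm)
    then show ?thesis using flow[OF x a h(1) h1 p] by (simp add: algebra_simps abs_le_iff)
  qed
  show ?thesis
    by (rule smooth_subsolution[OF compact_Y d u0 eta c euler h0 e]) (use that in blast)+
qed

end

section \<open>The averaged finite-horizon cost\<close>

text \<open>
  Stone-Weierstrass for the algebra of those continuous functions that are Lipschitz in \<open>y\<close> on \<open>K\<close>,
  uniformly in \<open>u\<close>. It separates points by the coordinates of \<open>y\<close> and by the distances \<open>dist u u'\<close>, which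
  do not depend on \<open>y\<close> at all.
\<close>

lemma lipschitz_approximation:
  fixes k :: "(real^'m) \<times> 'u::metric_space \<Rightarrow> real"
  assumes U: "compact U" and K: "compact K" and k: "continuous_on (K \<times> U) k" and e: "0 < e"
  obtains g Lg where "continuous_on (UNIV \<times> U) g" "0 \<le> Lg"
    "\<And>u. u \<in> U \<Longrightarrow> Lg-lipschitz_on K (\<lambda>y. g (y, u))"
    "\<And>z. z \<in> K \<times> U \<Longrightarrow> \<bar>k z - g z\<bar> < e"
proof -
  let ?R = "{g. continuous_on (UNIV \<times> U) g \<and> (\<exists>B. \<forall>u\<in>U. B-lipschitz_on K (\<lambda>y. g (y, u)))}"
  have cK: "compact (K \<times> U)" using K U by (rule compact_Times)
  interpret function_ring_on ?R "K \<times> U"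
  proof (unfold_locales, goal_cases)
    case 1 show ?case by (rule cK)
  next
    case (2 g) then show ?case by (auto elim: continuous_on_subset)
  next
    case (3 g h)
    then obtain A B where "\<forall>u\<in>U. A-lipschitz_on K (\<lambda>y. g (y, u))" "\<forall>u\<in>U. B-lipschitz_on K (\<lambda>y. h (y, u))"
      by blast
    then have "\<forall>u\<in>U. (A + B)-lipschitz_on K (\<lambda>y. g (y, u) + h (y, u))"
      by (auto intro: lipschitz_on_add)
    with 3 show ?case by (auto intro: continuous_on_add)
  next
    case (4 g h)
    then obtain A B where AB: "\<And>u. u \<in> U \<Longrightarrow> A-lipschitz_on K (\<lambda>y. g (y, u))"
      "\<And>u. u \<in> U \<Longrightarrow> B-lipschitz_on K (\<lambda>y. h (y, u))"
      by blast
    have "compact (g ` (K \<times> U))" "compact (h ` (K \<times> U))"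
      using 4 by (auto intro!: compact_continuous_image cK elim!: continuous_on_subset)
    then obtain a b where a: "\<forall>x\<in>g ` (K \<times> U). norm x \<le> a" and b: "\<forall>x\<in>h ` (K \<times> U). norm x \<le> b"
      by (meson compact_imp_bounded bounded_iff)
    have "(\<bar>a\<bar> * B + \<bar>b\<bar> * A)-lipschitz_on K (\<lambda>y. g (y, u) * h (y, u))" if u: "u \<in> U" for u
    proof (rule lipschitz_onI)
      have A: "0 \<le> A" and B: "0 \<le> B" using AB[OF u] lipschitz_on_nonneg by blast+
      then show "0 \<le> \<bar>a\<bar> * B + \<bar>b\<bar> * A" by simp
      fix y z assume y: "y \<in> K" and z: "z \<in> K"
      have "g (y, u) * h (y, u) - g (z, u) * h (z, u)
          = g (y, u) * (h (y, u) - h (z, u)) + h (z, u) * (g (y, u) - g (z, u))"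
        by (simp add: algebra_simps)
      also have "\<bar>\<dots>\<bar> \<le> \<bar>g (y, u)\<bar> * \<bar>h (y, u) - h (z, u)\<bar> + \<bar>h (z, u)\<bar> * \<bar>g (y, u) - g (z, u)\<bar>"
        by (metis abs_mult abs_triangle_ineq)
      also have "\<dots> \<le> \<bar>a\<bar> * (B * dist y z) + \<bar>b\<bar> * (A * dist y z)"
      proof (intro add_mono mult_mono)
        show "\<bar>h (y, u) - h (z, u)\<bar> \<le> B * dist y z" "\<bar>g (y, u) - g (z, u)\<bar> \<le> A * dist y z"
          using lipschitz_onD[OF AB(2)[OF u] y z] lipschitz_onD[OF AB(1)[OF u] y z]
          by (simp_all add: dist_real_def)
        have "norm (g (y, u)) \<le> a" using a y u by blast
        then show "\<bar>g (y, u)\<bar> \<le> \<bar>a\<bar>" by simp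
        have "norm (h (z, u)) \<le> b" using b z u by blast
        then show "\<bar>h (z, u)\<bar> \<le> \<bar>b\<bar>" by simp
      qed auto
      finally show "dist (g (y, u) * h (y, u)) (g (z, u) * h (z, u)) \<le> (\<bar>a\<bar> * B + \<bar>b\<bar> * A) * dist y z"
        by (simp add: dist_real_def algebra_simps)
    qed
    with 4 show ?case by (auto intro: continuous_on_mult)
  next
    case (5 c) show ?case by (auto intro!: exI[of _ 0] lipschitz_on_constant)
  next
    case (6 p q)
    show ?case
    proof (cases "fst p = fst q")
      case True
      then have "snd p \<noteq> snd q" using 6 by (simp add: prod_eq_iff)
      then have "dist (snd p) (snd q) \<noteq> dist (snd q) (snd q)" by simp
      then show ?thesis
        by (intro bexI[of _ "\<lambda>z. dist (snd z) (snd q)"])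
          (auto intro!: continuous_intros exI[of _ 0] lipschitz_on_constant)
    next
      case False
      then obtain i where "fst p $ i \<noteq> fst q $ i" by (auto simp: vec_eq_iff)
      then show ?thesis
        by (intro bexI[of _ "\<lambda>z. fst z $ i"])
          (auto intro!: continuous_intros exI[of _ 1] lipschitz_onI dist_vec_nth_le)
    qed
  qed
  obtain g where g: "g \<in> ?R" "\<forall>z\<in>K \<times> U. \<bar>k z - g z\<bar> < e"
    using Stone_Weierstrass_basic[OF k e] by blast
  then obtain B where B: "\<forall>u\<in>U. B-lipschitz_on K (\<lambda>y. g (y, u))" by blast
  show ?thesis
  proof (rule that[of g "max 0 B"])
    show "(max 0 B)-lipschitz_on K (\<lambda>y. g (y, u))" if "u \<in> U" for u
      using B that by (auto intro: lipschitz_on_le)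
  qed (use g in auto)
qed

context invariant_system
begin

text \<open>
  The weight \<open>1 - t / T\<close> comes from averaging horizons: for a fixed control, the mean over \<open>s \<in> [0, T]\<close> of
  the cost up to time \<open>s\<close> is the cost up to time \<open>T\<close> with this weight. Taking one infimum after the
  averaging avoids any regularity question in the horizon \<open>s\<close>.
\<close>

definition weighted_val :: "((real^'m) \<times> 'u \<Rightarrow> real) \<Rightarrow> real \<Rightarrow> real^'m \<Rightarrow> real" where
  "weighted_val g T x = (INF u\<in>controls U. integral {0..T} (\<lambda>t. (1 - t / T) * g (traj f x u t, u t)))"

lemma weighted_integrable:
  assumes "u \<in> controls U" "continuous_on (UNIV \<times> U) g" "0 \<le> a"
  shows "(\<lambda>t. (1 - t / T) * g (traj f x u t, u t)) absolutely_integrable_on {a..b}"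
  by (rule control_integrable_weighted[OF assms(1) traj_continuous[OF assms(1,3)] assms(3) subset_UNIV
        compact_U assms(2)]) (auto simp: divide_inverse intro!: continuous_intros)

lemma weighted_bdd_below:
  assumes g: "continuous_on (UNIV \<times> U) g" and T: "0 < T"
  shows "bdd_below ((\<lambda>u. integral {0..T} (\<lambda>t. (1 - t / T) * g (traj f x u t, u t))) ` controls U)"
proof -
  obtain d where d: "0 \<le> d" "x \<in> thicken Y d" by (rule thicken_exhausts)
  obtain B where B: "0 \<le> B" "\<And>x u t. x \<in> thicken Y d \<Longrightarrow> u \<in> controls U \<Longrightarrow> 0 \<le> t \<Longrightarrow> t \<le> T \<Longrightarrow>
    norm (g (traj f x u t, u t)) \<le> B"
    using running_bounded[OF g d(1)] by blast
  show ?thesis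
  proof (rule bdd_below_running)
    fix u t assume u: "u \<in> controls U" and t: "0 \<le> t" "t \<le> T"
    show "\<bar>(1 - t / T) * g (traj f x u t, u t)\<bar> \<le> B"
      using mult_mono[of "\<bar>1 - t / T\<bar>" 1 "\<bar>g (traj f x u t, u t)\<bar>" B] B(2)[OF d(2) u t] t T
      by (simp add: abs_mult)
  qed (use T B in \<open>auto intro: absolutely_integrable_imp_integrable weighted_integrable[OF _ g]\<close>)
qed

lemma weighted_val_lipschitz:
  assumes g: "continuous_on (UNIV \<times> U) g" and T: "0 < T" and d: "0 \<le> d" and Lg: "0 \<le> Lg"
    and lip: "\<And>u. u \<in> U \<Longrightarrow> Lg-lipschitz_on (thicken Y (d * exp (L * T))) (\<lambda>y. g (y, u))"
  shows "(Lg * exp (L * T) * T)-lipschitz_on (thicken Y d) (weighted_val g T)"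
proof -
  let ?J = "\<lambda>x u. integral {0..T} (\<lambda>t. (1 - t / T) * g (traj f x u t, u t))"
  let ?K = "Lg * exp (L * T) * T"
  have K: "0 \<le> ?K" using Lg T by simp
  have J: "?J x u \<le> ?J z u + ?K * dist x z"
    if x: "x \<in> thicken Y d" and z: "z \<in> thicken Y d" and u: "u \<in> controls U" for x z u
  proof -
    note int = absolutely_integrable_imp_integrable[OF weighted_integrable[OF u g order_refl]]
    have "norm (integral {0..T} (\<lambda>t. (1 - t / T) * g (traj f x u t, u t) - (1 - t / T) * g (traj f z u t, u t)))
        \<le> (Lg * (dist x z * exp (L * T))) * (T - 0)"
    proof (rule norm_integral_le)
      fix t assume t: "t \<in> {0..T}"
      have "norm (g (traj f x u t, u t) - g (traj f z u t, u t)) \<le> Lg * dist (traj f x u t) (traj f z u t)"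
        using lipschitz_onD[OF lip[OF control_in[OF u]] traj_near[OF x u] traj_near[OF z u], of t t t] t d
        by (simp add: dist_norm)
      also have "\<dots> \<le> Lg * (dist x z * exp (L * T))"
      proof (rule mult_left_mono[OF _ Lg])
        have "dist (traj f x u t) (traj f z u t) \<le> dist x z * exp (L * t)"
          using traj_dependence[OF u, of t x z] t by (simp add: dist_norm)
        also have "\<dots> \<le> dist x z * exp (L * T)"
          using t by (intro mult_left_mono) (auto intro: mult_left_mono L_ge_0)
        finally show "dist (traj f x u t) (traj f z u t) \<le> dist x z * exp (L * T)" .
      qed
      finally have "norm (g (traj f x u t, u t) - g (traj f z u t, u t)) \<le> Lg * (dist x z * exp (L * T))" .
      then have "\<bar>1 - t / T\<bar> * \<bar>g (traj f x u t, u t) - g (traj f z u t, u t)\<bar> \<le> 1 * (Lg * (dist x z * exp (L * T)))"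
        using t T by (intro mult_mono) auto
      then show "norm ((1 - t / T) * g (traj f x u t, u t) - (1 - t / T) * g (traj f z u t, u t))
          \<le> Lg * (dist x z * exp (L * T))"
        by (simp add: abs_mult flip: right_diff_distrib)
    qed (use Lg T in \<open>auto intro!: integrable_diff int\<close>)
    then show ?thesis by (simp add: integral_diff int abs_le_iff mult_ac)
  qed
  have "weighted_val g T x - ?K * dist x z \<le> weighted_val g T z"
    if x: "x \<in> thicken Y d" and z: "z \<in> thicken Y d" for x z
    unfolding weighted_val_def[of g T z]
  proof (intro cINF_greatest controls_nonempty)
    fix u assume u: "u \<in> controls U"
    have "weighted_val g T x \<le> ?J x u"
      unfolding weighted_val_def by (rule cINF_lower[OF weighted_bdd_below[OF g T] u])
    then show "weighted_val g T x - ?K * dist x z \<le> ?J z u" using J[OF x z u] by simp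
  qed
  then show ?thesis
    by (intro lipschitz_onI K) (force simp: dist_real_def abs_le_iff dist_commute)
qed

text \<open>
  Any control \<open>u\<close> for the end point is prepended by the constant \<open>a\<close>, and \<open>window_shift\<close> is applied to the
  running cost \<open>g\<close> of the concatenation. The mean of \<open>g\<close> over \<open>[0, T]\<close> appearing there is at least \<open>v_T - e\<close>,
  by the definition of \<open>v_T\<close> as an infimum and the closeness of \<open>g\<close> to \<open>k\<close>.
\<close>

lemma weighted_val_step:
  assumes g: "continuous_on (UNIV \<times> U) g" and T: "0 < T" and x: "x \<in> thicken Y d" and d: "0 \<le> d"
    and a: "a \<in> U" and h: "0 < h" "h < 1" and B0: "0 \<le> B"
    and B: "\<And>z. z \<in> thicken Y (d * exp (L * (T + 1))) \<times> U \<Longrightarrow> \<bar>g z\<bar> \<le> B"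
    and gk: "\<And>z. z \<in> thicken Y (d * exp (L * (T + 1))) \<times> U \<Longrightarrow> \<bar>k z - g z\<bar> < e"
  shows "weighted_val g T x - integral {0..h} (\<lambda>t. g (traj f x (\<lambda>_. a) t, a))
      + h * (v_T f k U T x - e) - 4 * B / T * h\<^sup>2 \<le> weighted_val g T (traj f x (\<lambda>_. a) h)"
  unfolding weighted_val_def[of g T "traj f x (\<lambda>_. a) h"]
proof (intro cINF_greatest controls_nonempty)
  fix u assume u: "u \<in> controls U"
  let ?v = "prepend h a u" let ?p = "traj f x (\<lambda>_. a) h"
  let ?G = "\<lambda>t. g (traj f x ?v t, ?v t)"
  have v: "?v \<in> controls U" by (rule prepend_control[OF u a])
  have mem: "(traj f x ?v t, ?v t) \<in> thicken Y (d * exp (L * (T + 1))) \<times> U" if "t \<in> {0..T + h}" for t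
    using that traj_near[OF x v, of t "T + 1"] control_in[OF v, of t] d h by simp
  have "weighted_val g T x \<le> integral {0..T} (\<lambda>t. (1 - t / T) * ?G t)"
    unfolding weighted_val_def by (rule cINF_lower[OF weighted_bdd_below[OF g T] v])
  moreover have "integral {0..T} (\<lambda>t. (1 - t / T) * ?G t) - integral {0..h} ?G + h / T * integral {0..T} ?G
      - 4 * B * h\<^sup>2 / T \<le> integral {0..T} (\<lambda>s. (1 - s / T) * ?G (h + s))"
    by (rule window_shift[OF T h(1) running_integrable[OF v g] weighted_integrable[OF v g]])
      (use B mem in auto)
  moreover have "integral {0..T} (\<lambda>s. (1 - s / T) * ?G (h + s))
      = integral {0..T} (\<lambda>s. (1 - s / T) * g (traj f ?p u s, u s))"
    using h by (intro integral_cong) (simp add: running_prepend(2)[OF u a])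
  moreover have "integral {0..h} ?G = integral {0..h} (\<lambda>t. g (traj f x (\<lambda>_. a) t, a))"
    by (rule running_prepend(1)[OF u a less_imp_le[OF h(1)]])
  moreover have "h * (v_T f k U T x - e) \<le> h / T * integral {0..T} ?G"
  proof -
    have "cost T x ?v - integral {0..T} ?G = integral {0..T} (\<lambda>t. k (traj f x ?v t, ?v t) - ?G t)"
      unfolding cost_def
      by (intro integral_diff[symmetric] absolutely_integrable_imp_integrable running_integrable v g cont_k)
        auto
    also have "\<dots> \<le> integral {0..T} (\<lambda>t. e)"
    proof (rule integral_le)
      fix t assume "t \<in> {0..T}"
      then show "k (traj f x ?v t, ?v t) - ?G t \<le> e" using gk[OF mem[of t]] h by simp
    qed (auto intro!: absolutely_integrable_imp_integrable running_integrable continuous_on_diff v g cont_k)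
    finally have "optimal_cost T x - e * T \<le> integral {0..T} ?G"
      using optimal_cost_le[OF v, of T x] T by (simp add: mult.commute)
    then have "h / T * (optimal_cost T x - e * T) \<le> h / T * integral {0..T} ?G"
      using h T by (intro mult_left_mono) auto
    moreover have "h / T * (optimal_cost T x - e * T) = h * (v_T f k U T x - e)"
      using T by (simp add: v_T_eq field_simps)
    ultimately show ?thesis by simp
  qed
  moreover have "4 * B * h\<^sup>2 / T = 4 * B / T * h\<^sup>2" by simp
  ultimately show "weighted_val g T x - integral {0..h} (\<lambda>t. g (traj f x (\<lambda>_. a) t, a))
      + h * (v_T f k U T x - e) - 4 * B / T * h\<^sup>2
      \<le> integral {0..T} (\<lambda>s. (1 - s / T) * g (traj f ?p u s, u s))"
    by linarith
qed

end

section \<open>Smooth subsolutions built from the long-run value\<close>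

text \<open>
  The long-run value enters as a parameter \<open>vs\<close>, characterised by uniform convergence rather than by
  its definition as a limit.
\<close>

locale long_run_system = invariant_system U f L Y k
  for U :: "'u::metric_space set" and f :: "(real^'m) \<times> 'u \<Rightarrow> real^'m" and L Y k +
  fixes N :: "(real^'m) set" and vs :: "real^'m \<Rightarrow> real" and Lv :: real
  assumes open_N: "open N" and Y_N: "Y \<subseteq> N"
    and vs_uniform: "uniform_limit N (v_T f k U) vs at_top"
    and vs_lipschitz: "Lv-lipschitz_on N vs"
begin

lemma thicken_in_N: obtains d where "0 < d" "thicken Y d \<subseteq> N"
  using compact_subset_open_imp_cball_epsilon_subset[OF compact_Y open_N Y_N]
  unfolding thicken_def by blast

lemma vs_limit: "x \<in> N \<Longrightarrow> ((\<lambda>T. v_T f k U T x) \<longlongrightarrow> vs x) at_top"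
  by (rule tendsto_uniform_limitI[OF vs_uniform])

text \<open>
  Bellman's inequality divided by \<open>h + T\<close>: as \<open>T\<close> tends to infinity the cost of the initial piece
  disappears.
\<close>

lemma vs_monotone:
  assumes x: "x \<in> N" and p: "traj f x (\<lambda>_. a) h \<in> N" and a: "a \<in> U" and h: "0 \<le> h"
  shows "vs x \<le> vs (traj f x (\<lambda>_. a) h)"
proof -
  let ?p = "traj f x (\<lambda>_. a) h" and ?C = "cost h x (\<lambda>_. a)"
  have shift: "filterlim (\<lambda>T. h + T) at_top at_top"
    by (rule filterlim_tendsto_add_at_top[OF tendsto_const filterlim_ident])
  have inv: "((\<lambda>T. inverse (h + T)) \<longlongrightarrow> 0) at_top"
    by (rule filterlim_compose[OF tendsto_inverse_0_at_top shift]) (rule filterlim_ident)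
  have right: "((\<lambda>T. ?C * inverse (h + T) + (1 - h * inverse (h + T)) * v_T f k U T ?p)
      \<longlongrightarrow> ?C * 0 + (1 - h * 0) * vs ?p) at_top"
    by (intro tendsto_intros inv vs_limit p)
  have left: "((\<lambda>T. v_T f k U (h + T) x) \<longlongrightarrow> vs x) at_top"
    by (rule filterlim_compose[OF vs_limit[OF x] shift])
  have "\<forall>\<^sub>F T in at_top. v_T f k U (h + T) x
      \<le> ?C * inverse (h + T) + (1 - h * inverse (h + T)) * v_T f k U T ?p"
    using eventually_gt_at_top[of 0]
  proof eventually_elim
    case (elim T)
    have "optimal_cost (h + T) x / (h + T) \<le> (?C + optimal_cost T ?p) / (h + T)"
      using dynamic_programming[OF a h, of T x] elim h by (intro divide_right_mono) auto
    also have "\<dots> = ?C * inverse (h + T) + (1 - h * inverse (h + T)) * (optimal_cost T ?p / T)"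
    proof -
      have *: "1 - h * inverse (h + T) = T * inverse (h + T)" using elim h by (simp add: field_simps)
      show ?thesis unfolding * using elim by (simp add: divide_inverse algebra_simps)
    qed
    finally show ?case by (simp add: v_T_eq)
  qed
  from tendsto_le[OF trivial_limit_at_top_linorder right left this] show ?thesis by simp
qed

text \<open>
  Replaces \<open>vs\<close> in the equation that couples \<open>\<gamma>\<close> and \<open>\<xi>\<close>, which admits only \<open>C1\<close> test functions.
\<close>

lemma smooth_increasing_approximation:
  assumes e: "0 < e"
  obtains \<phi> where "\<phi> \<in> C1" "\<And>y. y \<in> Y \<Longrightarrow> \<bar>\<phi> y - vs y\<bar> \<le> e"
    "\<And>y u. y \<in> Y \<Longrightarrow> u \<in> U \<Longrightarrow> - e \<le> gradient \<phi> y \<bullet> f (y, u)"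
proof -
  obtain d where d: "0 < d" "thicken Y d \<subseteq> N" by (rule thicken_in_N)
  have sub: "thicken Y (d / 2) \<subseteq> N" using thicken_mono[of "d / 2" d Y] d by auto
  show ?thesis
  proof (rule smooth_subsolution_flow[of d Lv vs 0 "\<lambda>_. 0" 0 e])
    show "Lv-lipschitz_on (thicken Y d) vs" by (rule lipschitz_on_subset[OF vs_lipschitz d(2)])
    show "vs x - h * 0 - 0 * h\<^sup>2 \<le> vs (traj f x (\<lambda>_. a) h)"
      if "x \<in> thicken Y (d / 2)" "a \<in> U" "0 < h" "traj f x (\<lambda>_. a) h \<in> thicken Y d" for x a h
      using vs_monotone[of x a h] that sub d by auto
  qed (use d e that in \<open>auto intro: lipschitz_on_constant\<close>)
qed

text \<open>
  A smooth subsolution, up to \<open>e\<close>, of the Hamilton-Jacobi-Bellman equation of the long-run average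
  problem, in which \<open>vs\<close> takes the role of the ergodic constant. The horizon \<open>T\<close> is fixed first, so
  that \<open>v_T\<close> is uniformly close to \<open>vs\<close>; it determines the compact set \<open>K\<close> that trajectories cannot leave, on
  which \<open>k\<close> is then approximated; and only afterwards is the step length sent to zero.
\<close>

lemma smooth_long_run_subsolution:
  assumes e: "0 < e"
  obtains \<phi> where "\<phi> \<in> C1"
    "\<And>y u. y \<in> Y \<Longrightarrow> u \<in> U \<Longrightarrow> vs y - k (y, u) - e \<le> gradient \<phi> y \<bullet> f (y, u)"
proof -
  \<comment> \<open>Spent on replacing \<open>v_T\<close> by \<open>vs\<close>, on replacing \<open>k\<close> by \<open>g\<close> in the infimum and again at the
    point, and on the mollification.\<close>
  define e' where "e' = e / 4"
  have e': "0 < e'" using e by (simp add: e'_def)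
  obtain d where d: "0 < d" "thicken Y d \<subseteq> N" by (rule thicken_in_N)
  have "\<forall>\<^sub>F T in at_top. (\<forall>x\<in>N. dist (v_T f k U T x) (vs x) < e') \<and> 0 < T"
    using uniform_limitD[OF vs_uniform e'] eventually_gt_at_top[of 0] by (rule eventually_conj)
  then obtain T where T: "\<And>x. x \<in> N \<Longrightarrow> dist (v_T f k U T x) (vs x) < e'" "0 < T"
    using eventually_happens'[OF trivial_limit_at_top_linorder] by blast
  define K where "K = thicken Y (d * exp (L * (T + 1)))"
  have K: "compact K" unfolding K_def by (rule compact_thicken[OF compact_Y])
  have KT: "thicken Y (d * exp (L * T)) \<subseteq> K" "thicken Y (d * exp (L * 1)) \<subseteq> K" "thicken Y d \<subseteq> K"
  proof -
    have LT: "L * T \<le> L * (T + 1)" "L * 1 \<le> L * (T + 1)" "0 \<le> L * (T + 1)"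
      using mult_left_mono[of 1 "T + 1" L] mult_left_mono[of T "T + 1" L] L_ge_0 T(2) by auto
    then show "thicken Y (d * exp (L * T)) \<subseteq> K" "thicken Y (d * exp (L * 1)) \<subseteq> K"
      unfolding K_def using d by (intro thicken_mono mult_left_mono; simp)+
    have "d * 1 \<le> d * exp (L * (T + 1))" using LT d by (intro mult_left_mono) auto
    then show "thicken Y d \<subseteq> K" unfolding K_def by (intro thicken_mono) simp
  qed
  obtain g Lg where g: "continuous_on (UNIV \<times> U) g" and Lg: "0 \<le> Lg"
    and g_lip: "\<And>u. u \<in> U \<Longrightarrow> Lg-lipschitz_on K (\<lambda>y. g (y, u))"
    and gk: "\<And>z. z \<in> K \<times> U \<Longrightarrow> \<bar>k z - g z\<bar> < e'"
    by (rule lipschitz_approximation[OF compact_U K continuous_on_subset[OF cont_k] e']) blast+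
  have KU: "compact (K \<times> U)" by (intro compact_Times K compact_U)
  obtain B where B: "0 \<le> B" "\<And>z. z \<in> K \<times> U \<Longrightarrow> norm (g z) \<le> B"
    by (rule continuous_bounded_on_compact[OF KU continuous_on_subset[OF g]]) auto
  obtain M where M: "0 \<le> M" "\<And>x u t. x \<in> thicken Y d \<Longrightarrow> u \<in> controls U \<Longrightarrow> 0 \<le> t \<Longrightarrow> t \<le> 1 \<Longrightarrow>
      norm (f (traj f x u t, u t)) \<le> M"
    using running_bounded[OF cont_f less_imp_le[OF d(1)], of 1] by blast
  define \<eta> where "\<eta> = weighted_val g T"
  define c where "c z = g z - vs (fst z) + 2 * e'" for z
  have eta: "(Lg * exp (L * T) * T)-lipschitz_on (thicken Y d) \<eta>"
    unfolding \<eta>_def using d T Lg g_lip KT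
    by (intro weighted_val_lipschitz g) (auto intro: lipschitz_on_subset)
  have c_lip: "(Lg + Lv)-lipschitz_on (thicken Y d) (\<lambda>y. c (y, u))" if u: "u \<in> U" for u
  proof -
    have "(Lg + Lv + 0)-lipschitz_on (thicken Y d) (\<lambda>y. (g (y, u) - vs y) + 2 * e')"
      by (intro lipschitz_on_add lipschitz_on_diff lipschitz_on_constant
          lipschitz_on_subset[OF g_lip[OF u] KT(3)] lipschitz_on_subset[OF vs_lipschitz d(2)])
    then show ?thesis by (simp add: c_def)
  qed
  have flow: "\<eta> x - h * c (x, a) - (Lg * M + 4 * B / T) * h\<^sup>2 \<le> \<eta> (traj f x (\<lambda>_. a) h)"
    if x2: "x \<in> thicken Y (d / 2)" and a: "a \<in> U" and h: "0 < h" "h < 1" for x a h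
  proof -
    have x: "x \<in> thicken Y d" using x2 thicken_mono[of "d / 2" d Y] d by auto
    have u: "(\<lambda>_. a) \<in> controls U" by (rule const_control[OF a])
    have "integral {0..h} (\<lambda>t. g (traj f x (\<lambda>_. a) t, a)) \<le> integral {0..h} (\<lambda>t. g (x, a) + Lg * (M * h))"
    proof (rule integral_le)
      show "(\<lambda>t. g (traj f x (\<lambda>_. a) t, a)) integrable_on {0..h}"
        using running_integrable[OF u g order_refl] by (rule absolutely_integrable_imp_integrable)
      fix t assume t: "t \<in> {0..h}"
      have "norm (traj f x (\<lambda>_. a) t - x) \<le> M * t"
        using M(2)[OF x u] t h by (intro traj_const_displacement(1) a) auto
      also have "\<dots> \<le> M * h" using t M by (intro mult_left_mono) auto
      finally have "Lg * norm (traj f x (\<lambda>_. a) t - x) \<le> Lg * (M * h)" using Lg by (rule mult_left_mono)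
      moreover have "traj f x (\<lambda>_. a) t \<in> K"
        using traj_near[OF x u, of t 1] t h d KT(2) by auto
      then have "\<bar>g (traj f x (\<lambda>_. a) t, a) - g (x, a)\<bar> \<le> Lg * norm (traj f x (\<lambda>_. a) t - x)"
        using lipschitz_onD[OF g_lip[OF a], of "traj f x (\<lambda>_. a) t" x] x KT(3) by (auto simp: dist_norm)
      ultimately show "g (traj f x (\<lambda>_. a) t, a) \<le> g (x, a) + Lg * (M * h)" by linarith
    qed auto
    then have run: "integral {0..h} (\<lambda>t. g (traj f x (\<lambda>_. a) t, a)) \<le> h * g (x, a) + Lg * M * h\<^sup>2"
      using h by (simp add: power2_eq_square algebra_simps)
    have "vs x - e' \<le> v_T f k U T x" using T(1)[of x] x d by (auto simp: dist_real_def)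
    then have "h * (vs x - 2 * e') \<le> h * (v_T f k U T x - e')" using h by (intro mult_left_mono) auto
    moreover have "\<eta> x - integral {0..h} (\<lambda>t. g (traj f x (\<lambda>_. a) t, a))
      + h * (v_T f k U T x - e') - 4 * B / T * h\<^sup>2 \<le> \<eta> (traj f x (\<lambda>_. a) h)"
      unfolding \<eta>_def
      by (rule weighted_val_step[OF g T(2) x less_imp_le[OF d(1)] a h B(1)])
        (use B(2) gk in \<open>auto simp: K_def\<close>)
    moreover have "h * c (x, a) = h * g (x, a) - h * (vs x - 2 * e')" by (simp add: c_def algebra_simps)
    moreover have "(Lg * M + 4 * B / T) * h\<^sup>2 = Lg * M * h\<^sup>2 + 4 * B / T * h\<^sup>2" by (rule distrib_right)
    ultimately show ?thesis using run by linarith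
  qed
  obtain \<phi> where \<phi>: "\<phi> \<in> C1" "\<And>y u. y \<in> Y \<Longrightarrow> u \<in> U \<Longrightarrow> - c (y, u) - e' \<le> gradient \<phi> y \<bullet> f (y, u)"
    by (rule smooth_subsolution_flow[OF d(1) eta c_lip flow e']) blast+
  show ?thesis
  proof (rule that[OF \<phi>(1)])
    fix y u assume y: "y \<in> Y" and u: "u \<in> U"
    have "y \<in> K" using y KT(3) subset_thicken[of d Y] d by auto
    then have "\<bar>k (y, u) - g (y, u)\<bar> < e'" using gk u by blast
    then show "vs y - k (y, u) - e \<le> gradient \<phi> y \<bullet> f (y, u)"
      using \<phi>(2)[OF y u] unfolding c_def fst_conv e'_def by linarith
  qed
qed

end

section \<open>The long-run value and the linear program\<close>

lemma integrable_continuous_on_compact: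
  fixes g :: "'a::topological_space \<Rightarrow> real"
  assumes M: "sets M = sets (restrict_space borel S)" and fin: "finite_measure M"
    and S: "compact S" and g: "continuous_on S g"
  shows "integrable M g"
proof -
  interpret finite_measure M by (rule fin)
  have sp: "space M = S" using sets_eq_imp_space_eq[OF M] by (simp add: space_restrict_space)
  obtain B where B: "\<And>x. x \<in> S \<Longrightarrow> norm (g x) \<le> B"
    using continuous_bounded_on_compact[OF S g] by blast
  have "g \<in> borel_measurable M"
    using borel_measurable_continuous_on_restrict[OF g] measurable_cong_sets[OF M refl] by blast
  then show ?thesis by (rule integrable_const_bound[where B=B, rotated]) (auto simp: sp intro!: AE_I2 B[simplified])
qed

context long_run_system
begin

text \<open>
  One test function for each equation defining \<open>Omega\<close>: the smooth approximation of \<open>vs\<close> in the coupling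
  equation gives \<open>vs y0 \<le> LINT \<gamma>. vs\<close> up to \<open>e\<close> times the mass of \<open>\<xi>\<close>, and the subsolution in the
  invariance equation gives \<open>LINT \<gamma>. vs \<le> LINT \<gamma>. k\<close> up to \<open>e\<close>.
\<close>

lemma vs_le_k_integral:
  assumes y0: "y0 \<in> Y" and om: "(\<gamma>, \<xi>) \<in> Omega f U Y y0"
  shows "vs y0 \<le> (LINT z|\<gamma>. k z)"
proof -
  have YU: "compact (Y \<times> U)" by (intro compact_Times compact_Y compact_U)
  from om have g: "sets \<gamma> = sets (restrict_space borel (Y \<times> U))" "prob_space \<gamma>"
    and x: "sets \<xi> = sets (restrict_space borel (Y \<times> U))" "finite_measure \<xi>"
    and inv: "\<And>\<phi>. \<phi> \<in> C1 \<Longrightarrow> (LINT z|\<gamma>. gradient \<phi> (fst z) \<bullet> f z) = 0"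
    and eq: "\<And>\<phi>. \<phi> \<in> C1 \<Longrightarrow> (LINT z|\<gamma>. \<phi> y0 - \<phi> (fst z)) + (LINT z|\<xi>. gradient \<phi> (fst z) \<bullet> f z) = 0"
    by (auto simp: Omega_def W_def borel_prob_measures_def borel_finite_measures_def)
  interpret G: prob_space \<gamma> by (rule g)
  interpret X: finite_measure \<xi> by (rule x)
  have sg: "space \<gamma> = Y \<times> U" and sx: "space \<xi> = Y \<times> U"
    using sets_eq_imp_space_eq[OF g(1)] sets_eq_imp_space_eq[OF x(1)] by (simp_all add: space_restrict_space)
  have ig: "integrable \<gamma> F" if "continuous_on (Y \<times> U) F" for F :: "_ \<Rightarrow> real"
    by (rule integrable_continuous_on_compact[OF g(1) G.finite_measure_axioms YU that])
  have ix: "integrable \<xi> F" if "continuous_on (Y \<times> U) F" for F :: "_ \<Rightarrow> real"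
    by (rule integrable_continuous_on_compact[OF x YU that])
  have flow: "continuous_on (Y \<times> U) (\<lambda>z. gradient \<phi> (fst z) \<bullet> f z)" if "\<phi> \<in> C1" for \<phi>
    using gradient_flow_continuous[OF that] by (rule continuous_on_subset) auto
  have vs_cont: "continuous_on (Y \<times> U) (\<lambda>z. vs (fst z))"
    using Y_N by (intro continuous_on_compose2[OF lipschitz_on_continuous_on[OF vs_lipschitz]] continuous_intros) auto
  have k_cont: "continuous_on (Y \<times> U) k" using cont_k by (rule continuous_on_subset) auto
  let ?v = "LINT z|\<gamma>. vs (fst z)"
  have small: "vs y0 - (LINT z|\<gamma>. k z) \<le> e * (measure \<xi> (space \<xi>) + 3)" if e: "0 < e" for e
  proof -
    obtain \<phi> where phi: "\<phi> \<in> C1" "\<And>y. y \<in> Y \<Longrightarrow> \<bar>\<phi> y - vs y\<bar> \<le> e"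
      "\<And>y u. y \<in> Y \<Longrightarrow> u \<in> U \<Longrightarrow> - e \<le> gradient \<phi> y \<bullet> f (y, u)"
      using smooth_increasing_approximation[OF e] by metis
    obtain \<psi> where psi: "\<psi> \<in> C1"
      "\<And>y u. y \<in> Y \<Longrightarrow> u \<in> U \<Longrightarrow> vs y - k (y, u) - e \<le> gradient \<psi> y \<bullet> f (y, u)"
      using smooth_long_run_subsolution[OF e] by metis
    have phi_cont: "continuous_on (Y \<times> U) (\<lambda>z. \<phi> (fst z))"
      by (intro continuous_on_compose2[OF C1_continuous[OF phi(1), of UNIV]] continuous_intros) auto
    have "(LINT z|\<xi>. - e) \<le> (LINT z|\<xi>. gradient \<phi> (fst z) \<bullet> f z)"
      by (intro integral_mono ix flow phi) (auto simp: sx phi(3))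
    then have "(LINT z|\<gamma>. \<phi> y0 - \<phi> (fst z)) \<le> e * measure \<xi> (space \<xi>)"
      using eq[OF phi(1)] by (simp add: mult.commute)
    moreover have "(LINT z|\<gamma>. vs y0 - vs (fst z) - 2 * e) \<le> (LINT z|\<gamma>. \<phi> y0 - \<phi> (fst z))"
    proof (intro integral_mono ig)
      fix z assume "z \<in> space \<gamma>"
      then show "vs y0 - vs (fst z) - 2 * e \<le> \<phi> y0 - \<phi> (fst z)"
        using phi(2)[OF y0] phi(2)[of "fst z"] by (auto simp: sg abs_le_iff)
    qed (intro continuous_intros vs_cont phi_cont)+
    moreover have "(LINT z|\<gamma>. vs y0 - vs (fst z) - 2 * e) = vs y0 - ?v - 2 * e"
      by (simp add: ig vs_cont G.prob_space)
    ultimately have 1: "vs y0 - ?v \<le> e * measure \<xi> (space \<xi>) + 2 * e" by simp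
    have "(LINT z|\<gamma>. vs (fst z) - k z - e) \<le> (LINT z|\<gamma>. gradient \<psi> (fst z) \<bullet> f z)"
      by (intro integral_mono ig flow psi continuous_intros vs_cont k_cont) (auto simp: sg psi(2))
    also have "\<dots> = 0" by (rule inv[OF psi(1)])
    also have "(LINT z|\<gamma>. vs (fst z) - k z - e) = ?v - (LINT z|\<gamma>. k z) - e"
      by (simp add: ig vs_cont k_cont G.prob_space)
    finally show ?thesis using 1 by (simp add: algebra_simps)
  qed
  have "vs y0 - (LINT z|\<gamma>. k z) \<le> 0"
  proof (rule field_le_epsilon)
    fix e :: real assume e: "0 < e"
    have m: "0 < measure \<xi> (space \<xi>) + 3" using measure_nonneg[of \<xi> "space \<xi>"] by linarith
    show "vs y0 - (LINT z|\<gamma>. k z) \<le> 0 + e"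
      using small[of "e / (measure \<xi> (space \<xi>) + 3)"] m e by simp
  qed
  then show ?thesis by simp
qed

lemma vs_le_k_star:
  assumes "y0 \<in> Y"
  shows "ereal (vs y0) \<le> k_star f k U Y y0"
  unfolding k_star_def by (rule INF_greatest) (auto intro: vs_le_k_integral[OF assms])

end

section \<open>The long-run value and the dual program\<close>

context long_run_system
begin

text \<open>
  Along a trajectory from \<open>y0\<close> the function \<open>\<psi>\<close> does not decrease, so the term \<open>\<psi> y0 - \<psi> y\<close> may be
  dropped. What remains, \<open>\<mu> \<le> k + gradient \<eta> \<bullet> f\<close>, integrates to a lower bound of the cost by \<open>\<mu> * T\<close> up to
  the oscillation of \<open>\<eta>\<close> on \<open>Y\<close>, which is negligible after division by \<open>T\<close>.
\<close>

lemma dual_feasible_le_vs: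
  assumes y0: "y0 \<in> Y" and psi: "\<psi> \<in> C1" and eta: "\<eta> \<in> C1"
    and feas: "\<And>y u. y \<in> Y \<Longrightarrow> u \<in> U \<Longrightarrow> 0 \<le> k (y, u) + (\<psi> y0 - \<psi> y) + gradient \<eta> y \<bullet> f (y, u) - \<mu>"
    and incr: "\<And>y u. y \<in> Y \<Longrightarrow> u \<in> U \<Longrightarrow> 0 \<le> gradient \<psi> y \<bullet> f (y, u)"
  shows "\<mu> \<le> vs y0"
proof -
  obtain B where B: "0 \<le> B" "\<And>y. y \<in> Y \<Longrightarrow> norm (\<eta> y) \<le> B"
    using continuous_bounded_on_compact[OF compact_Y C1_continuous[OF eta]] by blast
  have cost: "\<mu> * T - 2 * B \<le> cost T y0 u" if u: "u \<in> controls U" and T: "0 \<le> T" for u T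
  proof -
    let ?y = "traj f y0 u"
    have Y: "?y t \<in> Y" if "0 \<le> t" for t by (rule invariant[OF y0 u that])
    have int: "(\<lambda>t. gradient \<phi> (?y t) \<bullet> f (?y t, u t)) integrable_on {0..t}" if "\<phi> \<in> C1" for \<phi> t
      using running_integrable[OF u gradient_flow_continuous[OF that] order_refl, where x=y0]
      by (auto intro: absolutely_integrable_imp_integrable)
    have kint: "(\<lambda>t. k (?y t, u t)) integrable_on {0..T}"
      by (intro absolutely_integrable_imp_integrable running_integrable u cont_k order_refl)
    have psi_incr: "\<psi> y0 \<le> \<psi> (?y t)" if t: "0 \<le> t" for t
    proof -
      have "0 \<le> integral {0..t} (\<lambda>s. gradient \<psi> (?y s) \<bullet> f (?y s, u s))"
        using Y control_in[OF u] by (intro integral_nonneg int psi incr) auto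
      then show ?thesis using C1_along_traj[OF psi u t, of y0] by simp
    qed
    have "integral {0..T} (\<lambda>t. \<mu>) \<le> integral {0..T} (\<lambda>t. k (?y t, u t) + gradient \<eta> (?y t) \<bullet> f (?y t, u t))"
    proof (rule integral_le)
      fix t assume "t \<in> {0..T}"
      then show "\<mu> \<le> k (?y t, u t) + gradient \<eta> (?y t) \<bullet> f (?y t, u t)"
        using feas[OF Y control_in[OF u], of t t] psi_incr[of t] by auto
    qed (auto intro!: integrable_add kint int eta)
    also have "\<dots> = cost T y0 u + (\<eta> (?y T) - \<eta> y0)"
      using C1_along_traj[OF eta u T, of y0] by (simp add: cost_def integral_add kint int eta)
    finally show ?thesis
      using T B(2)[OF Y[OF T]] B(2)[OF y0] by (simp add: mult.commute abs_le_iff)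
  qed
  have "\<mu> - 2 * B * inverse T \<le> v_T f k U T y0" if T: "0 < T" for T
  proof -
    have "\<mu> * T - 2 * B \<le> optimal_cost T y0"
      unfolding optimal_cost_def using T by (intro cINF_greatest controls_nonempty cost) auto
    then have "(\<mu> * T - 2 * B) / T \<le> optimal_cost T y0 / T" using T by (intro divide_right_mono) auto
    then show ?thesis using T by (simp add: v_T_eq field_simps)
  qed
  then have "\<forall>\<^sub>F T in at_top. \<mu> - 2 * B * inverse T \<le> v_T f k U T y0"
    by (rule eventually_mono[OF eventually_gt_at_top[of 0]])
  moreover have "((\<lambda>T. \<mu> - 2 * B * inverse T) \<longlongrightarrow> \<mu> - 2 * B * 0) at_top"
    by (intro tendsto_intros tendsto_inverse_0_at_top filterlim_ident)
  moreover have "y0 \<in> N" using y0 Y_N by blast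
  ultimately show ?thesis
    using tendsto_le[OF trivial_limit_at_top_linorder vs_limit] by fastforce
qed

lemma d_star_le_vs:
  assumes "y0 \<in> Y"
  shows "d_star f k U Y y0 \<le> ereal (vs y0)"
  unfolding d_star_def by (rule Sup_least) (auto intro!: dual_feasible_le_vs[OF assms])

end

section \<open>Occupation measures of periodic trajectories\<close>

definition occupation_measure ::
  "'a::topological_space set \<Rightarrow> real \<Rightarrow> (real \<Rightarrow> real) \<Rightarrow> (real \<Rightarrow> 'a) \<Rightarrow> 'a measure" where
  "occupation_measure S T w z =
     distr (density (lebesgue_on {0..T}) (\<lambda>s. ennreal (w s))) (restrict_space borel S) z"

lemma occupation_measure:
  fixes w :: "real \<Rightarrow> real"
  assumes w: "continuous_on {0..T} w" "\<forall>s\<in>{0..T}. 0 \<le> w s"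
    and z: "z \<in> lebesgue_on {0..T} \<rightarrow>\<^sub>M restrict_space borel S"
  shows "sets (occupation_measure S T w z) = sets (restrict_space borel S)"
    and "emeasure (occupation_measure S T w z) (space (occupation_measure S T w z)) = ennreal (integral {0..T} w)"
    and "continuous_on S h \<Longrightarrow> (\<lambda>s. w s * h (z s)) absolutely_integrable_on {0..T} \<Longrightarrow>
      (LINT x|occupation_measure S T w z. h x) = integral {0..T} (\<lambda>s. w s * h (z s))"
proof -
  let ?P = "lebesgue_on {0..T}" let ?D = "density ?P (\<lambda>s. ennreal (w s))"
  have wm: "w \<in> borel_measurable ?P" using w by (intro continuous_imp_measurable_on_sets_lebesgue) auto
  have w0: "AE s in ?P. 0 \<le> w s" using w by (intro AE_I2) auto
  have zD: "z \<in> ?D \<rightarrow>\<^sub>M restrict_space borel S" using z by simp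
  have leb: "(LINT s|?P. F s) = integral {0..T} F" "integrable ?P F"
    if "F absolutely_integrable_on {0..T}" for F :: "real \<Rightarrow> real"
  proof -
    show "integrable ?P F"
      using that by (simp add: integrable_restrict_space set_integrable_def)
    then show "(LINT s|?P. F s) = integral {0..T} F" by (rule lebesgue_integral_eq_integral) simp
  qed
  show "sets (occupation_measure S T w z) = sets (restrict_space borel S)"
    by (simp add: occupation_measure_def)
  have wint: "w absolutely_integrable_on {0..T}"
    using w by (intro absolutely_integrable_continuous_real)
  have "emeasure (occupation_measure S T w z) (space (occupation_measure S T w z)) = emeasure ?D (space ?D)"
    unfolding occupation_measure_def space_distr
    by (subst emeasure_distr[OF zD sets.top]) (use measurable_space[OF zD] in \<open>auto intro!: arg_cong[where f="emeasure ?D"]\<close>)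
  also have "\<dots> = (\<integral>\<^sup>+ s. ennreal (w s) \<partial>?P)"
    using wm by (subst emeasure_density) (auto intro!: nn_integral_cong simp: indicator_def)
  also have "\<dots> = ennreal (LINT s|?P. w s)" by (rule nn_integral_eq_integral[OF leb(2)[OF wint] w0])
  finally show "emeasure (occupation_measure S T w z) (space (occupation_measure S T w z)) = ennreal (integral {0..T} w)"
    by (simp add: leb wint)
  assume h: "continuous_on S h" and int: "(\<lambda>s. w s * h (z s)) absolutely_integrable_on {0..T}"
  have hm: "h \<in> borel_measurable (restrict_space borel S)" by (rule borel_measurable_continuous_on_restrict[OF h])
  have "(LINT x|occupation_measure S T w z. h x) = (LINT s|?D. h (z s))"
    unfolding occupation_measure_def by (rule integral_distr[OF zD hm])
  also have "\<dots> = (LINT s|?P. w s *\<^sub>R h (z s))"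
    by (rule integral_density[OF measurable_compose[OF z hm] wm w0])
  also have "\<dots> = integral {0..T} (\<lambda>s. w s * h (z s))" using leb(1)[OF int] by simp
  finally show "(LINT x|occupation_measure S T w z. h x) = integral {0..T} (\<lambda>s. w s * h (z s))" .
qed

context invariant_system
begin

text \<open>
  Invariance of \<open>\<gamma>\<close> is the chain rule over one period. For the coupling equation, the time average of
  \<open>\<phi> (y t) - \<phi> y0\<close> is by the chain rule the average over \<open>t\<close> of the integrals of \<open>gradient \<phi> \<bullet> f\<close> over
  \<open>[0, t]\<close>, and exchanging the order of integration gives time \<open>s\<close> the weight \<open>(T - s) / T\<close>.
\<close>

lemma periodic_occupation_in_Omega:
  assumes y0: "y0 \<in> Y" and u: "u \<in> controls U" and T: "0 < T" and per: "traj f y0 u T = y0"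
  obtains \<gamma> \<xi> where "(\<gamma>, \<xi>) \<in> Omega f U Y y0"
    "(LINT z|\<gamma>. k z) = 1 / T * integral {0..T} (\<lambda>t. k (traj f y0 u t, u t))"
proof -
  let ?y = "traj f y0 u" let ?z = "\<lambda>s. (?y s, u s)"
  define \<gamma> where "\<gamma> = occupation_measure (Y \<times> U) T (\<lambda>_. 1 / T) ?z"
  define \<xi> where "\<xi> = occupation_measure (Y \<times> U) T (\<lambda>s. (T - s) / T) ?z"
  have yY: "?y ` {0..T} \<subseteq> Y" using invariant[OF y0 u] by auto
  have yc: "continuous_on {0..T} ?y" by (rule traj_continuous[OF u order_refl])
  have z: "?z \<in> lebesgue_on {0..T} \<rightarrow>\<^sub>M restrict_space borel (Y \<times> U)"
    by (rule control_pair_measurable[OF u yc order_refl yY])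
  have wc: "continuous_on {0..T} (\<lambda>s. 1 / T)" "continuous_on {0..T} (\<lambda>s. (T - s) / T)"
    using T by (auto intro!: continuous_intros)
  have w0: "\<forall>s\<in>{0..T}. 0 \<le> 1 / T" "\<forall>s\<in>{0..T}. 0 \<le> (T - s) / T" using T by auto
  note occ1 = occupation_measure[OF wc(1) w0(1) z, folded \<gamma>_def]
  note occ2 = occupation_measure[OF wc(2) w0(2) z, folded \<xi>_def]
  have wint: "(\<lambda>s. w s * h (?z s)) absolutely_integrable_on {0..T}"
    if "continuous_on {0..T} w" "continuous_on (UNIV \<times> U) h" for w and h :: "_ \<Rightarrow> real"
    by (rule control_integrable_weighted[OF u yc order_refl subset_UNIV compact_U that(2,1)])
  have sub: "continuous_on (Y \<times> U) h" if "continuous_on (UNIV \<times> U) h" for h :: "_ \<Rightarrow> real"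
    using that by (rule continuous_on_subset) auto
  have int1: "(LINT x|\<gamma>. h x) = 1 / T * integral {0..T} (\<lambda>s. h (?z s))"
    if h: "continuous_on (UNIV \<times> U) h" for h :: "_ \<Rightarrow> real"
    unfolding occ1(3)[OF sub[OF h] wint[OF wc(1) h]] by (rule integral_mult_right)
  have int2: "(LINT x|\<xi>. h x) = 1 / T * integral {0..T} (\<lambda>s. (T - s) * h (?z s))"
    if h: "continuous_on (UNIV \<times> U) h" for h :: "_ \<Rightarrow> real"
    unfolding occ2(3)[OF sub[OF h] wint[OF wc(2) h]] by (subst integral_mult_right[symmetric]) simp
  have "prob_space \<gamma>" using occ1(2) T by (intro prob_spaceI) simp
  then have g: "\<gamma> \<in> borel_prob_measures (Y \<times> U)" using occ1(1) by (simp add: borel_prob_measures_def)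
  have "finite_measure \<xi>" using occ2(2) by (intro finite_measureI) simp
  then have x: "\<xi> \<in> borel_finite_measures (Y \<times> U)" using occ2(1) by (simp add: borel_finite_measures_def)
  have W: "(LINT z|\<gamma>. gradient \<phi> (fst z) \<bullet> f z) = 0" if phi: "\<phi> \<in> C1" for \<phi>
    using int1[OF gradient_flow_continuous[OF phi]] C1_along_traj[OF phi u, of T y0] T per by simp
  have Om: "(LINT z|\<gamma>. \<phi> y0 - \<phi> (fst z)) + (LINT z|\<xi>. gradient \<phi> (fst z) \<bullet> f z) = 0"
    if phi: "\<phi> \<in> C1" for \<phi>
  proof -
    let ?G = "\<lambda>s. gradient \<phi> (?y s) \<bullet> f (?y s, u s)"
    note gc = gradient_flow_continuous[OF phi]
    have phic: "continuous_on (UNIV \<times> U) (\<lambda>z. \<phi> y0 - \<phi> (fst z))"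
      by (intro continuous_intros continuous_on_compose2[OF C1_continuous[OF phi, of UNIV]]) auto
    obtain B where B: "\<And>t. t \<in> {0..T} \<Longrightarrow> norm (?G t) \<le> B"
      using running_bounded[OF gc order_refl, of T] y0 u subset_thicken[of 0 Y] by (metis atLeastAtMost_iff fst_conv order_refl subsetD)
    have "integral {0..T} (\<lambda>s. \<phi> y0 - \<phi> (?y s)) = integral {0..T} (\<lambda>s. - integral {0..s} ?G)"
      using C1_along_traj[OF phi u, of _ y0] by (intro integral_cong) auto
    also have "\<dots> = - integral {0..T} (\<lambda>s. (T - s) * ?G s)"
    proof -
      have "integral {0..T} (\<lambda>s. integral {0..s} ?G) = integral {0..T} (\<lambda>s. (T - s) * ?G s)"
      proof (rule iterated_integral_eq_weighted)
        show "?G integrable_on {0..T}"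
          using running_integrable[OF u gc order_refl, where x=y0] by (auto intro: absolutely_integrable_imp_integrable)
        show "(\<lambda>s. s * ?G s) integrable_on {0..T}"
          using wint[OF continuous_on_id gc] by (auto intro: absolutely_integrable_imp_integrable)
      qed (use T B in auto)
      then show ?thesis by simp
    qed
    finally show ?thesis using int1[OF phic] int2[OF gc] by simp
  qed
  have "(\<gamma>, \<xi>) \<in> Omega f U Y y0" using g x W Om by (simp add: Omega_def W_def)
  then show ?thesis using int1[OF cont_k] by (rule that)
qed

lemma k_star_le_v_per:
  assumes y0: "y0 \<in> Y"
  shows "k_star f k U Y y0 \<le> v_per f k U Y y0"
  unfolding v_per_def
proof (rule Inf_greatest, elim CollectE exE conjE)
  fix r T y u
  assume r: "r = ereal (1 / T * (LINT t:{0..T}|lebesgue. k (y t, u t)))" and T: "0 < T"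
    and "(y, u) \<in> admissible_periodic_pairs f U Y y0 T"
  then have u: "u \<in> controls U" and y: "y = traj f y0 u" and per: "periodic_from_0 T y"
    by (auto simp: admissible_periodic_pairs_def admissible_controls_def)
  have "traj f y0 u T = y0"
    using per[unfolded periodic_from_0_def, rule_format, of 0] traj_0[OF u, of y0] by (simp add: y)
  from periodic_occupation_in_Omega[OF y0 u T this]
  obtain \<gamma> \<xi> where om: "(\<gamma>, \<xi>) \<in> Omega f U Y y0"
    and eq: "(LINT z|\<gamma>. k z) = 1 / T * integral {0..T} (\<lambda>t. k (traj f y0 u t, u t))" .
  have "k_star f k U Y y0 \<le> ereal (LINT z|\<gamma>. k z)"
    unfolding k_star_def by (rule INF_lower2[OF om]) simp
  also have "\<dots> = r"
    unfolding r y eq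
    by (simp add: set_lebesgue_integral_eq_integral(2) running_integrable[OF u cont_k order_refl])
  finally show "k_star f k U Y y0 \<le> r" .
qed

end

section \<open>The equality of values\<close>

theorem corollary3p2:
  fixes U :: "'u::metric_space set"
    and f :: "(real^'m) \<times> 'u \<Rightarrow> real^'m"
    and k :: "(real^'m) \<times> 'u \<Rightarrow> real"
    and Y N :: "(real^'m) set"
    and y0 :: "real^'m"
  assumes "compact U"
    and "continuous_on (UNIV \<times> U) f"
    and "\<exists>L. \<forall>u\<in>U. L-lipschitz_on UNIV (\<lambda>y. f (y, u))"
    and "continuous_on (UNIV \<times> U) k"
    and "compact Y"
    and "Y = closure (interior Y)"
    and forward_invariant: "\<forall>y\<in>Y. admissible_controls f U Y y = controls U"
    and "open N" and "Y \<subseteq> N"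
    and limit_exists: "\<forall>y\<in>N. \<exists>l. ((\<lambda>T. v_T f k U T y) \<longlongrightarrow> l) at_top"
    and limit_uniform: "uniform_limit N (v_T f k U) (v_star f k U) at_top"
    and limit_Lipschitz: "\<exists>L. L-lipschitz_on N (v_star f k U)"
    and "y0 \<in> Y"
    and "Omega f U Y y0 \<noteq> {}"
    and "d_star f k U Y y0 = k_star f k U Y y0 \<or>
         v_per f k U Y y0 = Liminf at_top (\<lambda>T. ereal (v_T f k U T y0))"
  shows "ereal (v_star f k U y0) = k_star f k U Y y0"
proof -
  obtain L where L: "\<And>u. u \<in> U \<Longrightarrow> L-lipschitz_on UNIV (\<lambda>y. f (y, u))"
    using \<open>\<exists>L. \<forall>u\<in>U. L-lipschitz_on UNIV (\<lambda>y. f (y, u))\<close> by blast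
  obtain Lv where Lv: "Lv-lipschitz_on N (v_star f k U)" using limit_Lipschitz by blast
  obtain \<gamma> \<xi> where "(\<gamma>, \<xi>) \<in> Omega f U Y y0" using \<open>Omega f U Y y0 \<noteq> {}\<close> by auto
  then have "sets \<gamma> = sets (restrict_space borel (Y \<times> U))" "prob_space \<gamma>"
    by (auto simp: Omega_def borel_prob_measures_def)
  \<comment> \<open>A feasible pair of measures exists only over a nonempty \<open>U\<close>; this supplies constant controls.\<close>
  then have "U \<noteq> {}"
    using prob_space.not_empty[of \<gamma>] sets_eq_imp_space_eq[of \<gamma>] by (auto simp: space_restrict_space)
  interpret long_run_system U f L Y k N "v_star f k U" Lv
  proof
    show "traj f y u t \<in> Y" if "y \<in> Y" "u \<in> controls U" "0 \<le> t" for y u t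
      using forward_invariant that unfolding admissible_controls_def by blast
  qed (use assms L Lv \<open>U \<noteq> {}\<close> in auto)
  have lower: "ereal (v_star f k U y0) \<le> k_star f k U Y y0"
    by (rule vs_le_k_star[OF \<open>y0 \<in> Y\<close>])
  have upper: "k_star f k U Y y0 \<le> ereal (v_star f k U y0)"
    using \<open>d_star f k U Y y0 = k_star f k U Y y0 \<or>
         v_per f k U Y y0 = Liminf at_top (\<lambda>T. ereal (v_T f k U T y0))\<close>
  proof
    assume "d_star f k U Y y0 = k_star f k U Y y0"
    then show ?thesis using d_star_le_vs[OF \<open>y0 \<in> Y\<close>] by simp
  next
    assume per: "v_per f k U Y y0 = Liminf at_top (\<lambda>T. ereal (v_T f k U T y0))"
    have "y0 \<in> N" using \<open>y0 \<in> Y\<close> \<open>Y \<subseteq> N\<close> by blast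
    then have "((\<lambda>T. ereal (v_T f k U T y0)) \<longlongrightarrow> ereal (v_star f k U y0)) at_top"
      by (intro tendsto_ereal vs_limit)
    from lim_imp_Liminf[OF trivial_limit_at_top_linorder this]
    show ?thesis using k_star_le_v_per[OF \<open>y0 \<in> Y\<close>] per by simp
  qed
  show ?thesis using lower upper by (rule antisym)
qed

end
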